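(* The extremal function $F_n$ of the extremal problem is constant if and only if $D_n^\infty=\sum_{k=1}^n\chi_{\{\mathbf c_k\}}$ for points $\mathbf c_1,\dots,\mathbf c_n$ such that $x_*,\mathbf c_1,\dots,\mathbf c_n$ lie in $n+1$ pairwise distinct gaps of $\mathsf E$. (In particular, if $d_n=D_n^\infty(x_* )>0$, $F_n$ is nonconstant.)
   Context: Let $\mathsf E\subset\overline{\mathbb R}$ be a compact proper subset with infinitely many points; gaps are the connected components of $\overline{\mathbb R}\setminus\mathsf E$. Divisors are finitely supported $D:\overline{\mathbb C}\to\mathbb Z$; for rational $f$, $(f)_\infty$ is its polar divisor ($0$ for constants); $\mathcal L(D)=\{f\text{ rational}:(f)_\infty\le D\}$. For $\mathbf c\in\overline{\mathbb R}$, $r(z,\mathbf c)=1/(\mathbf c-z)$ if $\mathbf c\neq\infty$, $r(z,\infty)=z$. Fix $n\ge1$, an integral divisor $D_n^\infty\ge0$ of degree $n$ supported in $\overline{\mathbb R}\setminus\mathsf E$, and $x_*\in\overline{\mathbb R}\setminus\mathsf E$; $d_n=D_n^\infty(x_* )$, $\mathcal L_n=\mathcal L(D_n^\infty)$. The extremal problem maximizes $\Re\lim_{x\to x_*}F(x)/r(x,x_* )^{d_n}$ over $F\in\mathcal L_n$ with $\sup_{\mathsf E}|F|\le1$; its maximizer exists and is unique and is denoted $F_n$. *)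

theory Defs
  imports "HOL-Analysis.Analysis" "HOL-Computational_Algebra.Computational_Algebra" "HOL-Computational_Algebra.Field_as_Ring"
begin

text \<open>Points of the Riemann sphere are represented by \<open>complex option\<close>,
  where \<open>None\<close> is the point at infinity and \<open>Some z\<close> the finite point z.\<close>

definition sph_open :: "complex option set \<Rightarrow> bool" where
  "sph_open U \<longleftrightarrow> open {z. Some z \<in> U} \<and>
     (None \<in> U \<longrightarrow> (\<exists>R. \<forall>z. norm z > R \<longrightarrow> Some z \<in> U))"

lemma istopology_sph_open: "istopology sph_open"
  unfolding istopology_def
proof (intro conjI allI impI)
  fix S T assume ST: "sph_open S" "sph_open T"
  have "{z. Some z \<in> S \<inter> T} = {z. Some z \<in> S} \<inter> {z. Some z \<in> T}" by auto
  moreover have "None \<in> S \<inter> T \<longrightarrow> (\<exists>R. \<forall>z. norm z > R \<longrightarrow> Some z \<in> S \<inter> T)"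
  proof
    assume "None \<in> S \<inter> T"
    then obtain R1 R2 where "\<forall>z. norm z > R1 \<longrightarrow> Some z \<in> S" "\<forall>z. norm z > R2 \<longrightarrow> Some z \<in> T"
      using ST unfolding sph_open_def by blast
    then show "\<exists>R. \<forall>z. norm z > R \<longrightarrow> Some z \<in> S \<inter> T"
      by (intro exI[of _ "max R1 R2"]) auto
  qed
  ultimately show "sph_open (S \<inter> T)" using ST unfolding sph_open_def by (simp add: open_Int)
next
  fix K assume K: "\<forall>S\<in>K. sph_open S"
  have "{z. Some z \<in> \<Union>K} = (\<Union>S\<in>K. {z. Some z \<in> S})" by auto
  moreover have "open (\<Union>S\<in>K. {z. Some z \<in> S})" using K unfolding sph_open_def by auto
  moreover have "None \<in> \<Union>K \<longrightarrow> (\<exists>R. \<forall>z. norm z > R \<longrightarrow> Some z \<in> \<Union>K)"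
  proof
    assume "None \<in> \<Union>K"
    then obtain S where "S \<in> K" "None \<in> S" by auto
    then obtain R where "\<forall>z. norm z > R \<longrightarrow> Some z \<in> S" using K unfolding sph_open_def by blast
    then show "\<exists>R. \<forall>z. norm z > R \<longrightarrow> Some z \<in> \<Union>K" using \<open>S \<in> K\<close> by blast
  qed
  ultimately show "sph_open (\<Union>K)" unfolding sph_open_def by simp
qed

definition sphere_top :: "complex option topology" where
  "sphere_top = topology sph_open"

lemma openin_sphere_top: "openin sphere_top = sph_open"
  unfolding sphere_top_def using istopology_sph_open by (rule topology_inverse')

definition ext_real :: "complex option set" where
  "ext_real = insert None (Some ` \<real>)"

text \<open>Rational functions are elements of the fraction field \<open>complex poly fract\<close>;
  \<open>rnum\<close>/\<open>rden\<close> give the reduced (coprime, normalized) numerator and denominator.\<close>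

type_synonym ratfun = "complex poly fract"

definition rnum :: "ratfun \<Rightarrow> complex poly" where "rnum F = fst (quot_of_fract F)"
definition rden :: "ratfun \<Rightarrow> complex poly" where "rden F = snd (quot_of_fract F)"

definition rconst :: "complex \<Rightarrow> ratfun" where "rconst c = Fract [:c:] 1"

definition is_constant_rf :: "ratfun \<Rightarrow> bool" where
  "is_constant_rf F \<longleftrightarrow> (\<exists>c. F = rconst c)"

definition polar_div :: "ratfun \<Rightarrow> complex option \<Rightarrow> int" where
  "polar_div F p = (case p of
      Some c \<Rightarrow> int (order c (rden F))
    | None \<Rightarrow> max 0 (int (degree (rnum F)) - int (degree (rden F))))"

text \<open>Value of F at a point of the sphere which is not a pole of F.\<close>
definition rf_eval :: "ratfun \<Rightarrow> complex option \<Rightarrow> complex" where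
  "rf_eval F p = (case p of
      Some z \<Rightarrow> poly (rnum F) z / poly (rden F) z
    | None \<Rightarrow> (if degree (rnum F) < degree (rden F) then 0
               else lead_coeff (rnum F) / lead_coeff (rden F)))"

definition is_divisor :: "(complex option \<Rightarrow> int) \<Rightarrow> bool" where
  "is_divisor D \<longleftrightarrow> finite {p. D p \<noteq> 0}"

definition div_degree :: "(complex option \<Rightarrow> int) \<Rightarrow> int" where
  "div_degree D = (\<Sum>p\<in>{p. D p \<noteq> 0}. D p)"

definition Lspace :: "(complex option \<Rightarrow> int) \<Rightarrow> ratfun set" where
  "Lspace D = {F. \<forall>p. polar_div F p \<le> D p}"

definition rfun :: "complex \<Rightarrow> complex option \<Rightarrow> complex" where
  "rfun z c = (case c of Some a \<Rightarrow> 1 / (a - z) | None \<Rightarrow> z)"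

definition real_approach :: "complex option \<Rightarrow> real filter" where
  "real_approach c = (case c of Some a \<Rightarrow> at (Re a) | None \<Rightarrow> at_infinity)"

definition extremal_functional :: "complex option \<Rightarrow> nat \<Rightarrow> ratfun \<Rightarrow> real" where
  "extremal_functional xs d F =
     Re (Lim (real_approach xs)
           (\<lambda>x::real. rf_eval F (Some (of_real x)) / rfun (of_real x) xs ^ d))"

definition admissible :: "complex option set \<Rightarrow> (complex option \<Rightarrow> int) \<Rightarrow> ratfun \<Rightarrow> bool" where
  "admissible E D F \<longleftrightarrow> F \<in> Lspace D \<and> (\<forall>x\<in>E. norm (rf_eval F x) \<le> 1)"

definition is_extremal :: "complex option set \<Rightarrow> (complex option \<Rightarrow> int) \<Rightarrow> complex option \<Rightarrow> ratfun \<Rightarrow> bool" where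
  "is_extremal E D xs F \<longleftrightarrow> admissible E D F \<and>
     (\<forall>G. admissible E D G \<longrightarrow>
        extremal_functional xs (nat (D xs)) G \<le> extremal_functional xs (nat (D xs)) F)"

definition same_gap :: "complex option set \<Rightarrow> complex option \<Rightarrow> complex option \<Rightarrow> bool" where
  "same_gap E x y \<longleftrightarrow> connected_component_of (subtopology sphere_top (ext_real - E)) x y"

end

theory Submission
  imports Defs
begin

text \<open>
  If \<open>D x\<^sub>* > 0\<close>, a small multiple of \<open>r(z, x\<^sub>*)\<^bsup>d\<^esup>\<close> beats every constant. Otherwise \<open>F\<close> is
  constant iff \<open>Re (G x\<^sub>*) \<le> 1\<close> for all admissible \<open>G\<close>.

  If the poles \<open>c\<^sub>1, \<dots>, c\<^sub>n\<close> and \<open>x\<^sub>*\<close> lie in distinct gaps, move \<open>x\<^sub>*\<close> to infinity and choose points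
  \<open>e\<^sub>0, \<dots>, e\<^sub>n\<close> of \<open>E\<close> interlacing with the poles. By Lagrange interpolation at infinity, \<open>F x\<^sub>*\<close> is an
  average with positive weights of the values \<open>F e\<^sub>j\<close>, so \<open>Re (F x\<^sub>*) \<ge> 1\<close> forces \<open>F e\<^sub>j = 1\<close> for all
  \<open>j\<close>, hence \<open>F = 1\<close>.

  Conversely, if a pole \<open>c\<close> lies in the gap of \<open>x\<^sub>*\<close>, or two poles \<open>c, c'\<close> (possibly equal) lie in one
  gap, then \<open>\<plusminus>(z - x\<^sub>*) / (z - c)\<close>, respectively \<open>\<plusminus>(z - x\<^sub>*)\<^sup>2 / ((z - c) (z - c'))\<close>, with the
  appropriate sign, is negative on \<open>E\<close> and vanishes at \<open>x\<^sub>*\<close>; scaling it and adding a constant gives an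
  admissible function whose value at \<open>x\<^sub>*\<close> exceeds 1.
\<close>

section \<open>Rational functions and divisors\<close>

text \<open>Evaluation of the degree \<open>n\<close> homogenization of \<open>P\<close> at \<open>(z : 1)\<close>, respectively at
  \<open>(1 : 0)\<close> for the point at infinity.\<close>

definition hev :: "nat \<Rightarrow> complex poly \<Rightarrow> complex option \<Rightarrow> complex" where
  "hev n P p = (case p of Some z \<Rightarrow> poly P z | None \<Rightarrow> coeff P n)"

lemma hev_Some [simp]: "hev n P (Some z) = poly P z"
  and hev_None [simp]: "hev n P None = coeff P n"
  by (simp_all add: hev_def)

lemma hev_add: "hev n (P + Q) p = hev n P p + hev n Q p"
  and hev_smult: "hev n (smult c P) p = c * hev n P p"
  by (simp_all add: hev_def split: option.split)

lemma coeff_mult_degree_bounds: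
  fixes P Q :: "'a :: idom poly"
  assumes "degree P \<le> m" "degree Q \<le> n"
  shows "coeff (P * Q) (m + n) = coeff P m * coeff Q n"
proof (cases "degree P = m \<and> degree Q = n")
  case True
  then show ?thesis using coeff_mult_degree_sum[of P Q] by auto
next
  case False
  then have "degree P < m \<or> degree Q < n" using assms by auto
  moreover have "degree (P * Q) \<le> degree P + degree Q" by (rule degree_mult_le)
  ultimately have "degree (P * Q) < m + n" using assms by linarith
  then show ?thesis using \<open>degree P < m \<or> degree Q < n\<close> by (auto simp: coeff_eq_0)
qed

text \<open>At infinity this compares coefficients in the formal top degrees, which is where both
  degree bounds enter.\<close>

lemma hev_mult:
  assumes "degree P \<le> m" "degree Q \<le> n"
  shows "hev (m + n) (P * Q) p = hev m P p * hev n Q p"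
  using assms by (cases p) (simp_all add: coeff_mult_degree_bounds)

lemma rden_nonzero [simp]: "rden F \<noteq> 0"
  by (simp add: rden_def)

lemma Fract_rnum_rden: "Fract (rnum F) (rden F) = F"
  by (simp add: rnum_def rden_def)

lemma coprime_rnum_rden: "coprime (rnum F) (rden F)"
  unfolding rnum_def rden_def by (rule coprime_quot_of_fract)

lemma rnum_rden_Fract:
  assumes "Q \<noteq> 0"
  shows "P * rden (Fract P Q) = rnum (Fract P Q) * Q"
proof -
  have "Fract (rnum (Fract P Q)) (rden (Fract P Q)) = Fract P Q" by (rule Fract_rnum_rden)
  then show ?thesis using assms by (simp add: eq_fract)
qed

text \<open>The reduced denominator divides the product of the reduced numerator and
  \<open>Q\<close>; the numerator is coprime to it and cancels.\<close>

lemma rden_dvd: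
  assumes "Q \<noteq> 0"
  shows "rden (Fract P Q) dvd Q"
proof -
  have "rden (Fract P Q) dvd rnum (Fract P Q) * Q"
    using rnum_rden_Fract[OF assms, of P] by (metis dvd_triv_right)
  then show ?thesis
    using coprime_rnum_rden[of "Fract P Q"] by (simp add: coprime_commute coprime_dvd_mult_right_iff)
qed

lemma rnum_zero_iff: "rnum F = 0 \<longleftrightarrow> F = 0"
  by (simp add: rnum_def)

lemma rden_0 [simp]: "rden 0 = 1" and rnum_0 [simp]: "rnum 0 = 0"
  by (simp_all add: rden_def rnum_def)

lemma degree_rnum_rden:
  assumes "Q \<noteq> 0" "P \<noteq> 0"
  shows "degree P + degree (rden (Fract P Q)) = degree (rnum (Fract P Q)) + degree Q"
proof -
  have "rnum (Fract P Q) \<noteq> 0" using assms by (simp add: rnum_zero_iff Zero_fract_def eq_fract)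
  then show ?thesis
    using arg_cong[OF rnum_rden_Fract[OF assms(1), of P], of degree] assms
    by (simp add: degree_mult_eq)
qed

text \<open>Evaluation from an unreduced fraction, uniformly at finite points and at infinity.
  Cross-multiplication with the reduced form settles finite points. At infinity the hypothesis on
  \<open>Q\<close> forces degree exactly \<open>n\<close>, so either leading coefficients are
  compared or both sides are 0.\<close>

lemma rf_eval_Fract:
  assumes P: "degree P \<le> n" and Q: "degree Q \<le> n" and nz: "hev n Q p \<noteq> 0"
  shows "rf_eval (Fract P Q) p = hev n P p / hev n Q p"
proof -
  have Q0: "Q \<noteq> 0" using nz by (auto simp: hev_def split: option.splits)
  define A where "A = rnum (Fract P Q)"
  define B where "B = rden (Fract P Q)"
  have eq: "P * B = A * Q" using rnum_rden_Fract[OF Q0] by (simp add: A_def B_def)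
  have B0: "B \<noteq> 0" by (simp add: B_def)
  show ?thesis
  proof (cases p)
    case (Some z)
    then have "poly Q z \<noteq> 0" using nz by simp
    moreover from this have "poly B z \<noteq> 0"
      using rden_dvd[OF Q0, of P] unfolding B_def by (metis dvdE mult_zero_left poly_mult)
    moreover have "poly P z * poly B z = poly A z * poly Q z"
      using arg_cong[OF eq, of "\<lambda>p. poly p z"] by simp
    ultimately show ?thesis
      using Some unfolding rf_eval_def A_def[symmetric] B_def[symmetric] by (simp add: field_simps)
  next
    case None
    then have degQ: "degree Q = n" "coeff Q n \<noteq> 0" using nz Q le_degree by force+
    show ?thesis
    proof (cases "P = 0")
      case True
      then have "Fract P Q = 0" by (simp add: fract_collapse)
      then show ?thesis using None True by (simp add: rf_eval_def)
    next
      case False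
      have d: "degree P + degree B = degree A + n"
        using degree_rnum_rden[OF Q0 False] degQ by (simp add: A_def B_def)
      have l: "lead_coeff P * lead_coeff B = lead_coeff A * lead_coeff Q"
        using arg_cong[OF eq, of lead_coeff] by (simp add: lead_coeff_mult)
      show ?thesis
      proof (cases "degree P = n")
        case True
        have "lead_coeff A / lead_coeff B = lead_coeff P / lead_coeff Q"
          using l B0 Q0 by (simp add: frac_eq_eq mult.commute)
        then show ?thesis using True d None degQ
          unfolding rf_eval_def A_def[symmetric] B_def[symmetric] by simp
      next
        case False
        then have "degree A < degree B" "coeff P n = 0" using d P by (auto intro: coeff_eq_0)
        then show ?thesis using None
          unfolding rf_eval_def A_def[symmetric] B_def[symmetric] by simp
      qed
    qed
  qed
qed

text \<open>Reduction can only lower finite pole orders, and it preserves the degree difference that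
  gives the pole at infinity. Hence the unreduced fraction may be tested.\<close>

lemma Fract_in_Lspace:
  assumes nn: "\<forall>p. D p \<ge> 0" and Q0: "Q \<noteq> 0"
    and ord: "\<And>a. int (order a Q) \<le> D (Some a)"
    and deg: "int (degree P) \<le> int (degree Q) + D None"
  shows "Fract P Q \<in> Lspace D"
  unfolding Lspace_def
proof (intro CollectI allI)
  fix p
  show "polar_div (Fract P Q) p \<le> D p"
  proof (cases p)
    case (Some a)
    have "order a (rden (Fract P Q)) \<le> order a Q"
      using Q0 rden_dvd[OF Q0] by (intro dvd_imp_order_le) auto
    then show ?thesis using ord[of a] Some by (simp add: polar_div_def)
  next
    case None
    show ?thesis
    proof (cases "P = 0")
      case True
      then have "Fract P Q = 0" by (simp add: fract_collapse)
      then show ?thesis using None nn by (simp add: polar_div_def)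
    next
      case False
      then show ?thesis using degree_rnum_rden[OF Q0 False] deg None nn
        by (auto simp: polar_div_def)
    qed
  qed
qed

section \<open>Divisibility by root multiplicities and the common denominator of
  \<open>Lspace D\<close>\<close>

lemma complex_poly_dvd_by_order:
  fixes p q :: "complex poly"
  assumes "p \<noteq> 0" "q \<noteq> 0" "\<And>a. order a p \<le> order a q"
  shows "p dvd q"
proof -
  have sub: "{z. poly p z = 0} \<subseteq> {z. poly q z = 0}"
  proof
    fix z assume "z \<in> {z. poly p z = 0}"
    then have "order z p \<noteq> 0" using assms(1) by (simp add: order_root)
    then have "order z q \<noteq> 0" using assms(3)[of z] by linarith
    then show "z \<in> {z. poly q z = 0}" by (auto simp: order_root)
  qed
  have fin: "finite {z. poly q z = 0}" using assms(2) by (rule poly_roots_finite)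
  \<comment> \<open>Both polynomials split into linear factors: first the exponents are raised, then
    the remaining roots of \<open>q\<close> are added.\<close>
  have "(\<Prod>z|poly p z = 0. [:-z, 1:] ^ order z p) dvd (\<Prod>z|poly p z = 0. [:-z, 1:] ^ order z q)"
    by (intro prod_dvd_prod le_imp_power_dvd assms(3))
  also have "\<dots> dvd (\<Prod>z|poly q z = 0. [:-z, 1:] ^ order z q)"
    by (rule prod_dvd_prod_subset[OF fin sub])
  finally have "smult (lead_coeff p) (\<Prod>z|poly p z = 0. [:-z, 1:] ^ order z p) dvd
      smult (lead_coeff q) (\<Prod>z|poly q z = 0. [:-z, 1:] ^ order z q)"
    using assms(1) by (simp add: smult_dvd_iff dvd_smult)
  then show ?thesis by (simp only: complex_poly_decompose)
qed

text \<open>A common denominator for \<open>Lspace D\<close>. A pole at infinity is not a factor; it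
  appears only as a deficit of the degree below that of \<open>D\<close>.\<close>

definition div_den :: "(complex option \<Rightarrow> int) \<Rightarrow> complex poly" where
  "div_den D = (\<Prod>a\<in>{a. D (Some a) \<noteq> 0}. [:-a, 1:] ^ nat (D (Some a)))"

lemma finite_div_supp: "is_divisor D \<Longrightarrow> finite {a. D (Some a) \<noteq> 0}"
  unfolding is_divisor_def
  by (rule finite_imageD[of Some]) (auto elim: finite_subset[rotated])

lemma div_degree_split:
  assumes "is_divisor D"
  shows "div_degree D = D None + (\<Sum>a\<in>{a. D (Some a) \<noteq> 0}. D (Some a))"
proof -
  have "div_degree D = sum D (insert None (Some ` {a. D (Some a) \<noteq> 0}))"
    unfolding div_degree_def
  proof (rule sum.mono_neutral_left)
    show "{p. D p \<noteq> 0} \<subseteq> insert None (Some ` {a. D (Some a) \<noteq> 0})"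
    proof
      fix p assume "p \<in> {p. D p \<noteq> 0}"
      then show "p \<in> insert None (Some ` {a. D (Some a) \<noteq> 0})" by (cases p) auto
    qed
  qed (use finite_div_supp[OF assms] in auto)
  also have "\<dots> = D None + sum D (Some ` {a. D (Some a) \<noteq> 0})"
    using finite_div_supp[OF assms] by (subst sum.insert) auto
  finally show ?thesis by (simp add: sum.reindex)
qed

lemma div_den_nonzero [simp]: "div_den D \<noteq> 0"
  unfolding div_den_def by (cases "finite {a. D (Some a) \<noteq> 0}") auto

lemma degree_div_den:
  assumes "is_divisor D" "\<forall>p. D p \<ge> 0"
  shows "int (degree (div_den D)) = div_degree D - D None"
proof -
  have "degree (div_den D) = (\<Sum>a\<in>{a. D (Some a) \<noteq> 0}. nat (D (Some a)))"
    unfolding div_den_def by (subst degree_prod_sum_eq) (auto simp: degree_power_eq)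
  then show ?thesis using assms by (simp add: div_degree_split)
qed

lemma order_div_den:
  assumes "is_divisor D" "\<forall>p. D p \<ge> 0"
  shows "int (order a (div_den D)) = D (Some a)"
proof -
  let ?S = "{a. D (Some a) \<noteq> 0}"
  have fin: "finite ?S" using assms finite_div_supp by blast
  have o: "order a ([:-b, 1:] ^ nat (D (Some b))) = (if b = a then nat (D (Some a)) else 0)" for b
    by (auto simp: order_power_n_n intro: order_0I)
  have "order a (\<Prod>b\<in>S. [:-b, 1:] ^ nat (D (Some b))) = (\<Sum>b\<in>S. if b = a then nat (D (Some a)) else 0)"
    if "finite S" for S
    using that by (induction S) (auto simp: o order_mult)
  then have "order a (div_den D) = (\<Sum>b\<in>?S. if b = a then nat (D (Some a)) else 0)"
    unfolding div_den_def using fin by blast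
  then show ?thesis using fin assms(2) by (auto simp: sum.delta)
qed

text \<open>The degree falls short of \<open>n\<close> by exactly \<open>D None\<close>, so the
  formal top coefficient detects the point at infinity in the same way as roots detect finite
  points.\<close>

lemma hev_div_den_nonzero_iff:
  assumes "is_divisor D" "\<forall>p. D p \<ge> 0" "div_degree D = int n"
  shows "hev n (div_den D) p \<noteq> 0 \<longleftrightarrow> D p = 0"
proof (cases p)
  case None
  have *: "int (degree (div_den D)) = int n - D None" using degree_div_den assms by metis
  show ?thesis
  proof (cases "D None = 0")
    case True
    then have "degree (div_den D) = n" using * by simp
    then show ?thesis using True None by (metis div_den_nonzero hev_None leading_coeff_neq_0)
  next
    case False
    then have "degree (div_den D) < n" using * assms(2) by (smt (verit) of_nat_less_iff)
    then show ?thesis using False None by (simp add: coeff_eq_0)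
  qed
next
  case (Some a)
  then show ?thesis using order_div_den[OF assms(1,2), of a] by (auto simp: order_root)
qed

text \<open>Expanding \<open>F\<close> by the cofactor of its reduced denominator reaches the common
  denominator; the bound on the pole at infinity then bounds the numerator. Problems about
  \<open>Lspace D\<close> thus become problems about polynomials of degree at most
  \<open>n\<close>.\<close>

lemma Lspace_Fract:
  assumes D: "is_divisor D" "\<forall>p. D p \<ge> 0" "div_degree D = int n" and F: "F \<in> Lspace D"
  obtains P where "degree P \<le> n" "F = Fract P (div_den D)"
proof -
  have pol: "polar_div F p \<le> D p" for p using F by (simp add: Lspace_def)
  have "rden F dvd div_den D"
  proof (rule complex_poly_dvd_by_order)
    fix a show "order a (rden F) \<le> order a (div_den D)"
      using pol[of "Some a"] order_div_den[OF D(1,2), of a] by (simp add: polar_div_def)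
  qed auto
  then obtain S where S: "div_den D = rden F * S" by blast
  then have S0: "S \<noteq> 0" using div_den_nonzero[of D] by force
  have "int (degree (rnum F * S)) \<le> int n"
  proof (cases "rnum F = 0")
    case False
    have "int (degree (rden F) + degree S) = int n - D None"
      using degree_div_den[OF D(1,2)] S S0 D(3) by (simp add: degree_mult_eq)
    then show ?thesis using pol[of None] False S0 by (auto simp: polar_div_def degree_mult_eq)
  qed auto
  moreover have "F = Fract (rnum F * S) (div_den D)"
    using S S0 Fract_rnum_rden[of F] by (metis eq_fract(1) div_den_nonzero mult.assoc mult.commute rden_nonzero)
  ultimately show ?thesis using that by auto
qed

section \<open>Topology of the extended real line\<close>

text \<open>The sign at infinity makes \<open>br q p\<close> below the bracket \<open>q\<^sub>1 p\<^sub>2 - q\<^sub>2 p\<^sub>1\<close> in homogeneous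
  coordinates, so that it is antisymmetric.\<close>

definition lin :: "complex option \<Rightarrow> complex poly" where
  "lin p = (case p of Some a \<Rightarrow> [:-a, 1:] | None \<Rightarrow> [:-1:])"

definition br :: "complex option \<Rightarrow> complex option \<Rightarrow> complex" where
  "br q p = hev 1 (lin p) q"

lemma br_simps [simp]:
  "br (Some z) (Some a) = z - a" "br (Some z) None = -1"
  "br None (Some a) = 1" "br None None = 0"
  by (simp_all add: br_def lin_def)

lemma br_antisym: "br p q = - br q p"
  by (cases p; cases q) simp_all

lemma br_zero_iff [simp]: "br p q = 0 \<longleftrightarrow> p = q"
  by (cases p; cases q) simp_all

lemma br_real: "p \<in> ext_real \<Longrightarrow> q \<in> ext_real \<Longrightarrow> br p q \<in> \<real>"
  by (auto simp: ext_real_def)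

lemma degree_lin: "degree (lin p) = (if p = None then 0 else 1)"
  and lin_nonzero [simp]: "lin p \<noteq> 0"
  and order_lin: "order a (lin p) = (if p = Some a then 1 else 0)"
  using order_power_n_n[of a 1] by (auto simp: lin_def intro: order_0I split: option.split)

text \<open>The squared norm of the homogeneous coordinates \<open>(z : 1)\<close> or
  \<open>(1 : 0)\<close> used for the brackets.\<close>

definition wt :: "complex option \<Rightarrow> real" where
  "wt p = (case p of Some z \<Rightarrow> 1 + (norm z)\<^sup>2 | None \<Rightarrow> 1)"

lemma wt_pos [simp]: "wt p > 0"
  by (auto simp: wt_def add_pos_nonneg split: option.split)

text \<open>On the extended real line, the sign of \<open>chi p q\<close> distinguishes the two arcs between \<open>p\<close> and
  \<open>q\<close>. Unlike \<open>Re (br z p * br z q) / wt z\<close>, it extends continuously to the whole sphere.\<close>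

definition chi :: "complex option \<Rightarrow> complex option \<Rightarrow> complex option \<Rightarrow> real" where
  "chi p q z = Re (br z p * cnj (br z q)) / wt z"

lemma chi_self: "chi p p z = (norm (br z p))\<^sup>2 / wt z"
  by (simp add: chi_def complex_mult_cnj cmod_power2)

section \<open>Continuity of \<open>chi\<close> on the sphere and signs on gaps\<close>

lemma topspace_sphere_top [simp]: "topspace sphere_top = UNIV"
proof -
  have "openin sphere_top UNIV" by (simp add: openin_sphere_top sph_open_def)
  then show ?thesis by (metis openin_subset top.extremum_uniqueI)
qed

lemma continuous_map_sphere_real:
  fixes f :: "complex option \<Rightarrow> real"
  assumes c: "continuous_on UNIV (\<lambda>z. f (Some z))"
    and l: "((\<lambda>z. f (Some z)) \<longlongrightarrow> f None) at_infinity"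
  shows "continuous_map sphere_top euclideanreal f"
  unfolding continuous_map
proof (intro conjI allI impI)
  fix V :: "real set" assume "openin euclideanreal V"
  then have V: "open V" by simp
  have "open ((\<lambda>z. f (Some z)) -` V)" using c V by (rule open_vimage[rotated])
  moreover have "\<exists>R. \<forall>z. norm z > R \<longrightarrow> f (Some z) \<in> V" if "f None \<in> V"
    using topological_tendstoD[OF l V that] by (auto simp: eventually_at_infinity intro: less_imp_le)
  ultimately show "openin sphere_top {x \<in> topspace sphere_top. f x \<in> V}"
    by (simp add: openin_sphere_top sph_open_def vimage_def)
qed simp

text \<open>Passing to \<open>w = 1/z\<close> near infinity takes a factor \<open>z\<close> out of
  each bracket. Thanks to the conjugation these combine to the squared norm of \<open>z\<close>,
  which cancels against \<open>wt\<close>.\<close>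

lemma continuous_map_chi: "continuous_map sphere_top euclideanreal (chi p q)"
proof (rule continuous_map_sphere_real)
  have nz: "1 + (norm z)\<^sup>2 \<noteq> 0" for z :: complex
    by (metis add_pos_nonneg less_irrefl zero_le_power2 zero_less_one)
  show "continuous_on UNIV (\<lambda>z. chi p q (Some z))"
    unfolding chi_def wt_def
    by (cases p; cases q) (auto intro!: continuous_intros simp: nz)
  \<comment> \<open>\<open>g r\<close> is the bracket with \<open>r\<close> in the chart
    \<open>w = 1/z\<close> after removal of the factor \<open>z\<close>, and \<open>k\<close> is
    \<open>chi p q\<close> in that chart.\<close>
  define g where "g r w = (case r of Some a \<Rightarrow> 1 - a * w | None \<Rightarrow> - w)" for r and w :: complex
  define k where "k w = Re (g p w * cnj (g q w)) / (1 + (norm w)\<^sup>2)" for w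
  have g: "br (Some z) r = z * g r (inverse z)" if "z \<noteq> 0" for z r
    using that by (cases r) (simp_all add: g_def field_simps)
  have k: "chi p q (Some z) = k (inverse z)" if "z \<noteq> 0" for z
  proof -
    have "br (Some z) p * cnj (br (Some z) q) = (z * cnj z) * (g p (inverse z) * cnj (g q (inverse z)))"
      by (simp add: g[OF that])
    also have "z * cnj z = of_real ((norm z)\<^sup>2)" by (simp only: complex_norm_square)
    finally have "Re (br (Some z) p * cnj (br (Some z) q))
        = (norm z)\<^sup>2 * Re (g p (inverse z) * cnj (g q (inverse z)))" by simp
    moreover have "1 + (norm z)\<^sup>2 = (norm z)\<^sup>2 * (1 + (norm (inverse z))\<^sup>2)"
      using that by (simp add: norm_divide power_divide field_simps)
    ultimately show ?thesis
      using that by (simp add: chi_def wt_def k_def del: times_complex.sel complex_cnj_mult)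
  qed
  have "isCont k 0"
    unfolding k_def g_def by (cases p; cases q) (auto intro!: continuous_intros)
  moreover have "k 0 = chi p q None"
    by (cases p; cases q) (simp_all add: k_def g_def chi_def wt_def)
  ultimately have "(k \<longlongrightarrow> chi p q None) (nhds 0)" by (simp add: continuous_at tendsto_nhds_iff)
  then have "((\<lambda>z. k (inverse z)) \<longlongrightarrow> chi p q None) at_infinity"
    by (rule filterlim_compose[OF _ tendsto_inverse_0])
  moreover have "eventually (\<lambda>z::complex. k (inverse z) = chi p q (Some z)) at_infinity"
    by (rule eventually_mono[OF eventually_not_equal_at_infinity[of 0]]) (simp add: k)
  ultimately show "((\<lambda>z. chi p q (Some z)) \<longlongrightarrow> chi p q None) at_infinity"
    by (rule Lim_transform_eventually)
qed

text \<open>\<open>chi p p\<close> is the squared chordal distance to \<open>p\<close> up to a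
  factor depending only on \<open>p\<close>: continuous, and positive away from \<open>p\<close>.
  Compactness gives both bounds.\<close>

lemma chi_bounds:
  assumes "compactin sphere_top E" "p \<notin> E"
  obtains \<delta> M where "0 < \<delta>" "\<And>e. e \<in> E \<Longrightarrow> \<delta> \<le> chi p p e \<and> chi p p e \<le> M"
proof (cases "E = {}")
  case False
  have "compact (chi p p ` E)"
    using image_compactin[OF assms(1) continuous_map_chi] by simp
  then obtain l u where "l \<in> E" "\<forall>e\<in>E. chi p p l \<le> chi p p e" "u \<in> E" "\<forall>e\<in>E. chi p p e \<le> chi p p u"
    using False compact_attains_inf[of "chi p p ` E"] compact_attains_sup[of "chi p p ` E"] by auto
  moreover have "chi p p l > 0"
    using \<open>l \<in> E\<close> assms(2) by (auto simp: chi_self intro!: divide_pos_pos)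
  ultimately show ?thesis using that by blast
qed (use that[of 1] in auto)

text \<open>The roles are exchanged: \<open>d\<close> and \<open>e\<close> stay fixed while a point
  runs through the gap from \<open>p\<close> to \<open>q\<close>. There \<open>chi d e\<close> has
  no zero, since its only zeros \<open>d\<close> and \<open>e\<close> lie in \<open>E\<close>, so
  its sign is constant.\<close>

lemma same_gap_sign:
  assumes "E \<subseteq> ext_real" "same_gap E p q" "d \<in> E" "e \<in> E"
  shows "Re (br d p * br d q) * Re (br e p * br e q) > 0"
proof -
  obtain T where T: "connectedin sphere_top T" "T \<subseteq> ext_real - E" "p \<in> T" "q \<in> T"
    using assms(2) by (auto simp: same_gap_def connected_component_of_def connectedin_subtopology)
  have c: "connected (chi d e ` T)"
    using connectedin_continuous_map_image[OF continuous_map_chi T(1), of d e] by simp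
  have form: "chi d e x = Re (br x d) * Re (br x e) / wt x" "Im (br x d) = 0" "Im (br x e) = 0"
    if "x \<in> T" for x
    using br_real[of x d] br_real[of x e] that T(2) assms
    by (auto simp: chi_def complex_is_Real_iff)
  have nz: "chi d e x \<noteq> 0" if "x \<in> T" for x
  proof -
    have "br x d \<noteq> 0" "br x e \<noteq> 0" using that T assms by auto
    then have "Re (br x d) \<noteq> 0" "Re (br x e) \<noteq> 0"
      using form[OF that] by (auto simp: complex_eq_iff)
    then show ?thesis using form[OF that] wt_pos[of x] by (simp del: wt_pos)
  qed
  \<comment> \<open>Otherwise connectedness of the image would produce the excluded value 0.\<close>
  have "\<not> (chi d e x < 0 \<and> chi d e y > 0)" if "x \<in> T" "y \<in> T" for x y
    using connectedD_interval[OF c, of "chi d e x" "chi d e y" 0] that nz by auto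
  then have "chi d e p * chi d e q > 0"
    using T(3,4) nz by (metis linorder_neqE_linordered_idom mult_neg_neg mult_pos_pos)
  then have "(chi d e p * chi d e q) * (wt p * wt q) > 0"
    by (intro mult_pos_pos[of _ "_ * _"] mult_pos_pos[of "wt p"] wt_pos)
  then have "(chi d e p * wt p) * (chi d e q * wt q) > 0" by (simp only: mult_ac)
  moreover have "chi d e p * wt p = Re (br p d) * Re (br p e)" "chi d e q * wt q = Re (br q d) * Re (br q e)"
    using form[OF T(3)] form[OF T(4)] less_imp_neq[OF wt_pos[of p]] less_imp_neq[OF wt_pos[of q]] by simp_all
  ultimately have "Re (br p d) * Re (br p e) * (Re (br q d) * Re (br q e)) > 0" by simp
  \<comment> \<open>The four brackets are regrouped by \<open>d\<close> and \<open>e\<close> instead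
    of \<open>p\<close> and \<open>q\<close>; the signs from antisymmetry cancel in pairs.\<close>
  moreover have "Re (br d p * br d q) = Re (br p d) * Re (br q d)"
    "Re (br e p * br e q) = Re (br p e) * Re (br q e)"
    using form[OF T(3)] form[OF T(4)] by (simp_all add: br_antisym[of d] br_antisym[of e])
  ultimately show ?thesis by (simp add: mult_ac)
qed

text \<open>\<open>phi p\<close> is the coordinate \<open>1 / (p - z)\<close> sending \<open>p\<close> to infinity (\<open>z\<close> if
  \<open>p\<close> is infinity already; the value at \<open>p\<close> is junk), and
  \<open>psi p\<close> is its inverse.\<close>

definition psi :: "complex option \<Rightarrow> real \<Rightarrow> complex option" where
  "psi p t = (case p of None \<Rightarrow> Some (of_real t)
    | Some a \<Rightarrow> if t = 0 then None else Some (a - 1 / of_real t))"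

definition phi :: "complex option \<Rightarrow> complex option \<Rightarrow> real" where
  "phi p q = (case (p, q) of (None, Some z) \<Rightarrow> Re z | (Some a, Some z) \<Rightarrow> Re (1 / (a - z)) | _ \<Rightarrow> 0)"

lemma psi_in: "p \<in> ext_real \<Longrightarrow> psi p t \<in> ext_real" "psi p t \<noteq> p"
  by (auto simp: psi_def ext_real_def split: option.split)

lemma phi_psi [simp]: "phi p (psi p t) = t"
  by (auto simp: phi_def psi_def split: option.split)

lemma psi_phi:
  assumes "p \<in> ext_real" "q \<in> ext_real" "q \<noteq> p"
  shows "psi p (phi p q) = q"
proof (cases p)
  case None
  then show ?thesis using assms by (auto simp: ext_real_def phi_def psi_def)
next
  case (Some a)
  show ?thesis
  proof (cases q)
    case (Some z)
    then obtain x y where "a = of_real x" "z = of_real y" "x \<noteq> y"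
      using \<open>p = Some a\<close> assms by (auto simp: ext_real_def elim!: Reals_cases)
    moreover from this have "1 / (a - z) = of_real (1 / (x - y))" by simp
    ultimately show ?thesis using \<open>p = Some a\<close> Some by (simp add: phi_def psi_def)
  qed (use Some in \<open>simp add: phi_def psi_def\<close>)
qed

text \<open>The only delicate parameter is \<open>t = 0\<close> for finite \<open>p\<close>, where
  the curve passes through infinity.\<close>

lemma continuous_map_psi: "continuous_map euclideanreal sphere_top (psi p)"
  unfolding continuous_map
proof (intro conjI allI impI)
  fix U assume "openin sphere_top U"
  then have U: "open {z. Some z \<in> U}" "None \<in> U \<longrightarrow> (\<exists>R. \<forall>z. norm z > R \<longrightarrow> Some z \<in> U)"
    by (auto simp: openin_sphere_top sph_open_def)
  have "open {t. psi p t \<in> U}"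
  proof (cases p)
    case None
    have "open ((of_real :: real \<Rightarrow> complex) -` {z. Some z \<in> U})"
      by (intro open_vimage U continuous_intros)
    then show ?thesis using None by (simp add: psi_def vimage_def)
  next
    case (Some a)
    let ?h = "\<lambda>t::real. a - 1 / of_real t"
    have "\<exists>A. open A \<and> t \<in> A \<and> A \<subseteq> {t. psi p t \<in> U}" if t: "psi p t \<in> U" for t
    proof (cases "t = 0")
      case False
      have "continuous_on (- {0}) ?h" by (intro continuous_intros) auto
      then have "open (- {0} \<inter> ?h -` {z. Some z \<in> U})"
        using U(1) by (intro continuous_open_preimage) auto
      then show ?thesis using t False Some
        by (intro exI[of _ "- {0} \<inter> ?h -` {z. Some z \<in> U}"]) (auto simp: psi_def)
    next
      case True
      then have "None \<in> U" using t Some by (simp add: psi_def)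
      then obtain R where R: "\<And>z. norm z > R \<Longrightarrow> Some z \<in> U" using U(2) by blast
      \<comment> \<open>For nonzero \<open>s\<close> with modulus below \<open>d\<close>,
        \<open>1 / s\<close> exceeds \<open>R\<close> in modulus by more than \<open>norm a\<close>,
        so subtracting it from \<open>a\<close> still gives a point outside the disc of radius
        \<open>R\<close>.\<close>
      define d where "d = 1 / (\<bar>R\<bar> + norm a + 1)"
      have "d > 0" by (simp add: d_def add_nonneg_pos)
      have "psi p s \<in> U" if "\<bar>s\<bar> < d" for s
      proof (cases "s = 0")
        case False
        have "\<bar>R\<bar> + norm a + 1 < 1 / \<bar>s\<bar>"
          using that False \<open>d > 0\<close> unfolding d_def by (simp add: field_simps)
        also have "1 / \<bar>s\<bar> = norm (1 / of_real s :: complex)" by (simp add: norm_divide)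
        finally have "norm (?h s) > R"
          using norm_triangle_ineq2[of "1 / of_real s :: complex" a] norm_minus_commute[of a "1 / of_real s"]
          by linarith
        then show ?thesis using R False Some by (simp add: psi_def)
      qed (use \<open>None \<in> U\<close> Some in \<open>simp add: psi_def\<close>)
      then show ?thesis using True \<open>d > 0\<close> by (intro exI[of _ "ball 0 d"]) auto
    qed
    then show ?thesis by (subst open_subopen) auto
  qed
  then show "openin euclideanreal {x \<in> topspace euclideanreal. psi p x \<in> U}" by simp
qed simp

text \<open>The curve \<open>psi p\<close> covers the extended real line except \<open>p\<close>,
  and both of its ends close up at \<open>p\<close>.\<close>

lemma psi_at_infinity:
  assumes "openin sphere_top U" "p \<in> U"
  shows "eventually (\<lambda>t. psi p t \<in> U) at_infinity"
proof (cases p)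
  case None
  then obtain R where "\<And>z. norm z > R \<Longrightarrow> Some z \<in> U"
    using assms by (auto simp: openin_sphere_top sph_open_def)
  then show ?thesis using None
    by (auto simp: eventually_at_infinity psi_def intro!: exI[of _ "R + 1"])
next
  case (Some a)
  have "((\<lambda>t::real. inverse (of_real t :: complex)) \<longlongrightarrow> 0) at_infinity"
    using tendsto_of_real[OF tendsto_inverse_0[where 'a = real], where 'a = complex] by simp
  then have "((\<lambda>t::real. a - inverse (of_real t)) \<longlongrightarrow> a - 0) at_infinity"
    by (intro tendsto_intros)
  moreover have "open {z. Some z \<in> U}" "a \<in> {z. Some z \<in> U}"
    using assms Some by (auto simp: openin_sphere_top sph_open_def)
  ultimately have "eventually (\<lambda>t::real. a - inverse (of_real t) \<in> {z. Some z \<in> U}) at_infinity"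
    by (auto dest: topological_tendstoD)
  with eventually_not_equal_at_infinity[of 0] show ?thesis
    by eventually_elim (use Some in \<open>simp add: psi_def inverse_eq_divide\<close>)
qed

lemma same_gap_arc:
  assumes "p \<in> ext_real" "s \<le> t" "\<And>u. s \<le> u \<Longrightarrow> u \<le> t \<Longrightarrow> psi p u \<notin> E"
  shows "same_gap E (psi p s) (psi p t)"
  unfolding same_gap_def connected_component_of_def connectedin_subtopology
proof (intro exI conjI)
  show "connectedin sphere_top (psi p ` {s..t})"
    by (rule connectedin_continuous_map_image[OF continuous_map_psi]) simp
qed (use assms psi_in in auto)

text \<open>The image of the ray is connected and has \<open>p\<close> in its closure, so adjoining
  \<open>p\<close> keeps it connected.\<close>

lemma same_gap_ray:
  assumes p: "p \<in> ext_real" "p \<notin> E" and S: "S = {..t} \<or> S = {t..}"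
    and nE: "\<And>u. u \<in> S \<Longrightarrow> psi p u \<notin> E"
  shows "same_gap E p (psi p t)"
  unfolding same_gap_def connected_component_of_def connectedin_subtopology
proof (intro exI conjI)
  have "\<exists>u\<in>S. psi p u \<in> U" if U: "openin sphere_top U" "p \<in> U" for U
  proof -
    obtain b where b: "\<And>u. b \<le> \<bar>u\<bar> \<Longrightarrow> psi p u \<in> U"
      using psi_at_infinity[OF U] by (auto simp: eventually_at_infinity)
    \<comment> \<open>These parameters are beyond the bound \<open>b\<close> and lie on the left and
      the right ray respectively, which treats both shapes of \<open>S\<close> at once.\<close>
    have "psi p (min t (-\<bar>b\<bar>)) \<in> U" "psi p (max t \<bar>b\<bar>) \<in> U"
      by (rule b, linarith)+
    moreover have "min t (-\<bar>b\<bar>) \<in> {..t}" "max t \<bar>b\<bar> \<in> {t..}" by simp_all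
    ultimately show ?thesis using S by blast
  qed
  then have "p \<in> sphere_top closure_of (psi p ` S)" by (auto simp: closure_of_def)
  moreover have "psi p ` S \<subseteq> sphere_top closure_of (psi p ` S)" by (rule closure_of_subset) simp
  moreover have "connectedin sphere_top (psi p ` S)"
    by (rule connectedin_continuous_map_image[OF continuous_map_psi]) (use S in auto)
  ultimately show "connectedin sphere_top (insert p (psi p ` S))"
    using connectedin_intermediate_closure_of[of sphere_top "psi p ` S" "insert p (psi p ` S)"] by blast
qed (use assms psi_in in auto)

section \<open>Interpolation at infinity\<close>

text \<open>The polynomial \<open>z^n P(1/z)\<close>. Reversing with respect to a fixed
  \<open>n\<close> instead of the degree makes the value at 0 the formal top coefficient.\<close>

definition hrev :: "nat \<Rightarrow> complex poly \<Rightarrow> complex poly" where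
  "hrev n P = (\<Sum>i\<le>n. monom (coeff P i) (n - i))"

lemma degree_hrev: "degree (hrev n P) \<le> n"
  unfolding hrev_def by (intro degree_sum_le) (auto intro: order_trans[OF degree_monom_le])

lemma coeff_hrev: "coeff (hrev n P) n = coeff P 0"
proof -
  have "coeff (hrev n P) n = (\<Sum>i\<le>n. if i = 0 then coeff P 0 else 0)"
    unfolding hrev_def coeff_sum by (intro sum.cong) auto
  then show ?thesis by simp
qed

lemma poly_hrev_0: "poly (hrev n P) 0 = coeff P n"
proof -
  have "poly (hrev n P) 0 = (\<Sum>i\<le>n. if i = n then coeff P n else 0)"
    unfolding hrev_def poly_sum by (intro sum.cong) (auto simp: poly_monom)
  then show ?thesis by simp
qed

lemma poly_hrev:
  assumes "degree P \<le> n" "z \<noteq> 0"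
  shows "z ^ n * poly (hrev n P) (1 / z) = poly P z"
proof -
  have "z ^ n * poly (hrev n P) (1 / z) = (\<Sum>i\<le>n. coeff P i * z ^ i)"
    unfolding hrev_def poly_sum sum_distrib_left
  proof (intro sum.cong refl)
    fix i assume "i \<in> {..n}"
    then have "z ^ n = z ^ (n - i) * z ^ i" by (simp flip: power_add)
    then show "z ^ n * poly (monom (coeff P i) (n - i)) (1 / z) = coeff P i * z ^ i"
      using assms(2) by (simp add: poly_monom power_divide)
  qed
  also have "\<dots> = (\<Sum>i\<le>degree P. coeff P i * z ^ i)"
    using assms(1) by (intro sum.mono_neutral_right) (auto simp: coeff_eq_0)
  finally show ?thesis by (simp add: poly_altdef)
qed

text \<open>The quotient is \<open>hrev n P\<close> at \<open>1/x\<close>, so the limit is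
  continuity of that polynomial at 0.\<close>

lemma poly_over_power_at_infinity:
  fixes P :: "complex poly"
  assumes "degree P \<le> n"
  shows "((\<lambda>x::real. poly P (of_real x) / of_real x ^ n) \<longlongrightarrow> coeff P n) at_infinity"
proof -
  have "((\<lambda>x::real. of_real (inverse x) :: complex) \<longlongrightarrow> 0) at_infinity"
    using tendsto_of_real[OF tendsto_inverse_0[where 'a = real], where 'a = complex] by simp
  then have "((\<lambda>x::real. poly (hrev n P) (of_real (inverse x))) \<longlongrightarrow> coeff P n) at_infinity"
    using tendsto_poly[of _ 0 _ "hrev n P"] by (simp add: poly_hrev_0)
  moreover have "\<forall>\<^sub>F x::real in at_infinity.
      poly (hrev n P) (of_real (inverse x)) = poly P (of_real x) / of_real x ^ n"
    by (rule eventually_mono[OF eventually_not_equal_at_infinity[of 0]])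
      (simp add: poly_hrev[OF assms, symmetric] inverse_eq_divide)
  ultimately show ?thesis by (rule Lim_transform_eventually)
qed

text \<open>The substitution moving \<open>p\<close> to infinity: \<open>T P\<close> is \<open>P\<close> in the coordinate \<open>phi p\<close>, up to
  the factor \<open>\<kappa>\<close>, which does not depend on \<open>P\<close>.\<close>

lemma moved_to_infinity:
  assumes "p \<in> ext_real"
  obtains T :: "complex poly \<Rightarrow> complex poly" and \<kappa> :: "real \<Rightarrow> complex"
  where "\<And>P. degree P \<le> n \<Longrightarrow> degree (T P) \<le> n"
    and "\<And>P. degree P \<le> n \<Longrightarrow> coeff (T P) n = hev n P p"
    and "\<And>P t. degree P \<le> n \<Longrightarrow> poly (T P) (of_real t) = \<kappa> t * hev n P (psi p t)"
    and "\<And>t. \<kappa> t \<noteq> 0"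
proof (cases p)
  case None
  show ?thesis
    by (rule that[of "\<lambda>P. P" "\<lambda>_. 1"]) (simp_all add: None psi_def)
next
  case (Some a)
  define S where "S P = pcompose P [:a, 1:]" for P
  have degS: "degree (S P) = degree P" for P by (simp add: S_def degree_pcompose)
  have coeffS: "coeff (S P) n = coeff P n" if "degree P \<le> n" for P
  proof (cases "degree P = n")
    case True
    then show ?thesis using lead_coeff_comp[of "[:a, 1:]" P] degS[of P] by (simp add: S_def)
  next
    case False
    then show ?thesis using that degS[of P] by (simp add: coeff_eq_0)
  qed
  \<comment> \<open>The coordinate is \<open>t = -1 / (z - a)\<close>: a translation, a reversal and
    a change of sign. The factor \<open>(-1) ^ n\<close> makes the top coefficient come out as the
    value at \<open>a\<close>.\<close>
  define T where "T P = smult ((-1) ^ n) (pcompose (hrev n (S P)) [:0, -1:])" for P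
  \<comment> \<open>At \<open>t = 0\<close> the point is infinity, where \<open>hev\<close> is
    already the top coefficient; the factor \<open>t ^ n\<close> would vanish there for positive
    \<open>n\<close>, so only the sign from \<open>T\<close> remains.\<close>
  define \<kappa> where "\<kappa> t = (if t = 0 then (-1) ^ n else of_real t ^ n :: complex)" for t :: real
  show ?thesis
  proof (rule that[of T \<kappa>])
    fix P :: "complex poly" and t :: real assume P: "degree P \<le> n"
    show "degree (T P) \<le> n"
      using degree_hrev[of n "S P"] by (simp add: T_def degree_pcompose)
    have "coeff (pcompose (hrev n (S P)) [:0, -1:]) n = (-1) ^ n * coeff (hrev n (S P)) n"
    proof (cases "degree (hrev n (S P)) = n")
      case True
      then show ?thesis
        using lead_coeff_comp[of "[:0, -1:]" "hrev n (S P)"] by (simp add: degree_pcompose mult.commute)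
    next
      case False
      then show ?thesis using degree_hrev[of n "S P"]
        by (simp add: coeff_eq_0 degree_pcompose)
    qed
    then show "coeff (T P) n = hev n P p"
      by (simp add: T_def coeff_hrev Some S_def poly_0_coeff_0[symmetric] poly_pcompose
          flip: mult.assoc power_mult_distrib)
    show "poly (T P) (of_real t) = \<kappa> t * hev n P (psi p t)"
    proof (cases "t = 0")
      case True
      then show ?thesis
        by (simp add: T_def \<kappa>_def psi_def Some poly_pcompose poly_hrev_0 coeffS[OF P])
    next
      case False
      let ?t = "of_real t :: complex"
      have "poly (S P) (- 1 / ?t) = (- 1 / ?t) ^ n * poly (hrev n (S P)) (1 / (- 1 / ?t))"
        using False P degS[of P] by (intro poly_hrev[symmetric]) auto
      then have "poly P (a - 1 / ?t) = (- 1 / ?t) ^ n * poly (hrev n (S P)) (- ?t)"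
        by (simp add: S_def poly_pcompose)
      then have "?t ^ n * poly P (a - 1 / ?t) = (?t * (- 1 / ?t)) ^ n * poly (hrev n (S P)) (- ?t)"
        by (simp only: power_mult_distrib mult.assoc)
      then show ?thesis
        using False by (simp add: T_def \<kappa>_def psi_def Some poly_pcompose)
    qed
  qed (simp add: \<kappa>_def)
qed

text \<open>Coefficients of \<open>X^n\<close> are compared in the Lagrange interpolation formula,
  whose unnormalized basis polynomials \<open>L j\<close> are monic of degree
  \<open>n\<close>.\<close>

lemma lagrange_lead_coeff:
  fixes P :: "'a :: field poly"
  assumes "degree P \<le> n" "inj_on x {..n}"
  shows "coeff P n = (\<Sum>j\<le>n. poly P (x j) / (\<Prod>i\<in>{..n}-{j}. x j - x i))"
proof -
  define L where "L j = (\<Prod>i\<in>{..n}-{j}. [:- x i, 1:])" for j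
  define l where "l j = (\<Prod>i\<in>{..n}-{j}. x j - x i)" for j
  define R where "R = (\<Sum>j\<le>n. smult (poly P (x j) / l j) (L j))"
  have degL: "degree (L j) = n" if "j \<le> n" for j
    unfolding L_def using that by (subst degree_prod_sum_eq) auto
  have coeffL: "coeff (L j) n = 1" if "j \<le> n" for j
    using lead_coeff_prod[of "\<lambda>i. [:- x i, 1:]" "{..n}-{j}"] degL[OF that] by (simp add: L_def)
  have l: "l j \<noteq> 0" if "j \<le> n" for j
    using that assms(2) by (auto simp: l_def inj_on_def)
  have polyL: "poly (L j) (x k) = (if j = k then l j else 0)" if "j \<le> n" "k \<le> n" for j k
    using that by (auto simp: L_def l_def poly_prod)
  have "P = R"
  proof (rule poly_eqI_degree[of "x ` {..n}"])
    fix z assume "z \<in> x ` {..n}"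
    then obtain k where k: "k \<le> n" "z = x k" by auto
    have "poly R (x k) = (\<Sum>j\<le>n. if j = k then poly P (x k) else 0)"
      unfolding R_def poly_sum using k l by (intro sum.cong) (auto simp: polyL)
    then show "poly P z = poly R z" using k by simp
  next
    have "degree R \<le> n" unfolding R_def
      by (intro degree_sum_le) (auto simp: degL intro: order_trans[OF degree_smult_le])
    then show "degree R < card (x ` {..n})" "degree P < card (x ` {..n})"
      using assms by (simp_all add: card_image)
  qed
  then have "coeff P n = coeff R n" by simp
  then show ?thesis by (simp add: R_def coeff_sum coeffL l_def)
qed

text \<open>The \<open>n\<close> nodes other than \<open>s j\<close> can be paired with the poles so
  that the two members of a pair lie on the same side of \<open>s j\<close>. Each quotient of
  differences is then positive.\<close>

lemma interlacing_weight_pos: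
  fixes s \<tau> :: "nat \<Rightarrow> real"
  assumes l: "\<And>j k. j \<le> k \<Longrightarrow> k < n \<Longrightarrow> s j < \<tau> k" and r: "\<And>j k. k < j \<Longrightarrow> j \<le> n \<Longrightarrow> \<tau> k < s j"
    and j: "j \<le> n"
  shows "(\<Prod>k<n. s j - \<tau> k) / (\<Prod>i\<in>{..n}-{j}. s j - s i) > 0"
proof -
  \<comment> \<open>Poles to the left of \<open>s j\<close> are paired with the node before them,
    poles to the right with the node after them; this skips the index \<open>j\<close>.\<close>
  define f where "f k = (if k < j then k else Suc k)" for k
  have mono: "s i < s k" if "i < k" "k \<le> n" for i k
    using l[of i i] r[of i k] that by linarith
  have "bij_betw f {..<n} ({..n} - {j})"
  proof (rule bij_betw_byWitness[of _ "\<lambda>i. if i < j then i else i - 1"])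
  qed (use j in \<open>auto simp: f_def\<close>)
  then have "(\<Prod>i\<in>{..n}-{j}. s j - s i) = (\<Prod>k<n. s j - s (f k))"
    using prod.reindex_bij_betw[of f _ _ "\<lambda>i. s j - s i"] by simp
  then have "(\<Prod>k<n. s j - \<tau> k) / (\<Prod>i\<in>{..n}-{j}. s j - s i) = (\<Prod>k<n. (s j - \<tau> k) / (s j - s (f k)))"
    by (simp add: prod_dividef)
  also have "\<dots> > 0"
  proof (rule prod_pos)
    fix k assume k: "k \<in> {..<n}"
    show "(s j - \<tau> k) / (s j - s (f k)) > 0"
    proof (cases "k < j")
      case True
      then show ?thesis using r[of k j] mono[of k j] j by (simp add: f_def)
    next
      case False
      then show ?thesis using l[of j k] mono[of j "Suc k"] k
        by (simp add: f_def divide_neg_neg)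
    qed
  qed
  finally show ?thesis .
qed

text \<open>The value of \<open>P / Q\<close> at infinity is an average, with positive weights, of its values at the
  points \<open>s j\<close>.\<close>

lemma interlacing_maximum_principle:
  fixes s \<tau> :: "nat \<Rightarrow> real" and P Q :: "complex poly"
  assumes l: "\<And>j k. j \<le> k \<Longrightarrow> k < n \<Longrightarrow> s j < \<tau> k" and r: "\<And>j k. k < j \<Longrightarrow> j \<le> n \<Longrightarrow> \<tau> k < s j"
    and P: "degree P \<le> n" and Q: "degree Q \<le> n" "coeff Q n \<noteq> 0"
    and roots: "\<And>k. k < n \<Longrightarrow> poly Q (of_real (\<tau> k)) = 0"
    and le: "\<And>j. j \<le> n \<Longrightarrow> norm (poly P (of_real (s j)) / poly Q (of_real (s j))) \<le> 1"
    and ge: "Re (coeff P n / coeff Q n) \<ge> 1"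
  shows "P = Q"
proof -
  have smono: "s i < s k" if "i < k" "k \<le> n" for i k
    using l[of i i] r[of i k] that by linarith
  have \<tau>mono: "\<tau> i < \<tau> k" if "i < k" "k < n" for i k
    using l[of k k] r[of i k] that by simp
  let ?x = "\<lambda>j. of_real (s j) :: complex"
  have inj: "inj_on ?x {..n}"
    by (rule linorder_inj_onI) (use smono in force)+
  have injt: "inj_on (\<lambda>k. of_real (\<tau> k) :: complex) {..<n}"
    by (rule linorder_inj_onI) (use \<tau>mono in force)+
  let ?R = "\<Prod>k<n. [:- of_real (\<tau> k), 1:] :: complex poly"
  have degR: "degree ?R = n" by (subst degree_prod_sum_eq) auto
  have coeffR: "coeff ?R n = 1"
    using lead_coeff_prod[of "\<lambda>k. [:- of_real (\<tau> k), 1:] :: complex poly" "{..<n}"] degR by simp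
  \<comment> \<open>The \<open>n\<close> distinct roots and the top coefficient determine
    \<open>Q\<close>.\<close>
  have QR: "Q = smult (coeff Q n) ?R"
  proof (rule poly_eqI_degree_lead_coeff[of _ n _ "(\<lambda>k. of_real (\<tau> k)) ` {..<n}"])
    fix z :: complex assume "z \<in> (\<lambda>k. of_real (\<tau> k)) ` {..<n}"
    then obtain k where "k < n" "z = of_real (\<tau> k)" by auto
    then show "poly Q z = poly (smult (coeff Q n) ?R) z"
      using roots by (auto simp: poly_prod)
  qed (use Q degR coeffR injt in \<open>auto simp: card_image\<close>)
  \<comment> \<open>The interpolation weights of the values of \<open>Q\<close>, divided by its top
    coefficient.\<close>
  define w where "w j = (\<Prod>k<n. s j - \<tau> k) / (\<Prod>i\<in>{..n}-{j}. s j - s i)" for j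
  have w: "w j > 0" if "j \<le> n" for j
    unfolding w_def by (rule interlacing_weight_pos[OF l r that])
  have wQ: "of_real (w j) = poly Q (?x j) / coeff Q n / (\<Prod>i\<in>{..n}-{j}. ?x j - ?x i)" for j
    using Q(2) by (subst (1) QR) (simp add: w_def poly_prod)
  define v where "v j = poly P (?x j) / poly Q (?x j)" for j
  have Qnz: "poly Q (?x j) \<noteq> 0" if "j \<le> n" for j
    using w[OF that] wQ[of j] by auto
  have sumv: "(\<Sum>j\<le>n. of_real (w j) * v j) = coeff P n / coeff Q n"
  proof -
    have "coeff P n / coeff Q n = (\<Sum>j\<le>n. poly P (?x j) / (\<Prod>i\<in>{..n}-{j}. ?x j - ?x i) / coeff Q n)"
      unfolding lagrange_lead_coeff[OF P inj] sum_divide_distrib ..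
    also have "\<dots> = (\<Sum>j\<le>n. of_real (w j) * v j)"
      using Qnz by (intro sum.cong) (auto simp: wQ v_def)
    finally show ?thesis ..
  qed
  \<comment> \<open>Interpolating \<open>Q\<close> itself amounts to averaging the constant value
    1.\<close>
  have sumw: "(\<Sum>j\<le>n. w j) = 1"
  proof -
    have "of_real (\<Sum>j\<le>n. w j) = (\<Sum>j\<le>n. poly Q (?x j) / (\<Prod>i\<in>{..n}-{j}. ?x j - ?x i)) / coeff Q n"
      unfolding of_real_sum wQ sum_divide_distrib by (intro sum.cong) auto
    also have "\<dots> = of_real 1"
      unfolding lagrange_lead_coeff[OF Q(1) inj, symmetric] using Q(2) by simp
    finally show ?thesis by (simp only: of_real_eq_iff)
  qed
  have "Re (coeff P n / coeff Q n) = (\<Sum>j\<le>n. w j * Re (v j))"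
    unfolding sumv[symmetric] by simp
  then have "(\<Sum>j\<le>n. w j * (1 - Re (v j))) \<le> 0"
    using ge sumw by (simp add: right_diff_distrib sum_subtractf)
  \<comment> \<open>A sum of nonnegative terms that is at most 0 has only zero terms.\<close>
  moreover have nn: "w j * (1 - Re (v j)) \<ge> 0" if "j \<le> n" for j
    using w[OF that] le[OF that] complex_Re_le_cmod[of "v j"] by (simp add: v_def)
  ultimately have "(\<Sum>j\<le>n. w j * (1 - Re (v j))) = 0"
    by (meson antisym sum_nonneg atMost_iff)
  then have "\<forall>j\<in>{..n}. w j * (1 - Re (v j)) = 0"
    using nn by (subst (asm) sum_nonneg_eq_0_iff) auto
  then have Re1: "Re (v j) = 1" if "j \<le> n" for j using w[OF that] that by force
  have v1: "v j = 1" if "j \<le> n" for j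
  proof -
    have "(Re (v j))\<^sup>2 + (Im (v j))\<^sup>2 \<le> 1"
      using power_le_one[OF norm_ge_zero le[OF that], of 2] by (simp add: v_def[symmetric] cmod_power2)
    then have "Im (v j) = 0" using Re1[OF that] by simp
    then show ?thesis using Re1[OF that] by (simp add: complex_eq_iff)
  qed
  \<comment> \<open>Agreement at the \<open>n + 1\<close> nodes suffices for degree at most
    \<open>n\<close>.\<close>
  show "P = Q"
  proof (rule poly_eqI_degree[of "?x ` {..n}"])
    fix z assume "z \<in> ?x ` {..n}"
    then obtain j where "j \<le> n" "z = ?x j" by auto
    then show "poly P z = poly Q z" using v1[of j] Qnz[of j] by (simp add: v_def)
  qed (use P Q inj in \<open>auto simp: card_image\<close>)
qed

section \<open>Competitors\<close>

lemma real_approach_nontrivial [simp]: "real_approach p \<noteq> bot"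
  using trivial_limit_at_infinity by (auto simp: real_approach_def split: option.split)

lemma eventually_real_approach:
  "p \<in> ext_real \<Longrightarrow> eventually (\<lambda>x. Some (of_real x) \<noteq> p) (real_approach p)"
  by (cases p) (auto simp: real_approach_def eventually_at_filter intro!: always_eventually)

text \<open>At infinity, numerator and denominator are both divided by \<open>x ^ n\<close> before
  passing to the limit.\<close>

lemma tendsto_rf_eval:
  assumes p: "p \<in> ext_real" and P: "degree P \<le> n" and Q: "degree Q \<le> n" "hev n Q p \<noteq> 0"
  shows "((\<lambda>x. rf_eval (Fract P Q) (Some (of_real x))) \<longlongrightarrow> rf_eval (Fract P Q) p) (real_approach p)"
proof (cases p)
  case (Some a)
  then obtain r where r: "a = of_real r" using p by (auto simp: ext_real_def elim!: Reals_cases)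
  have tQ: "((\<lambda>x::real. poly Q (of_real x)) \<longlongrightarrow> poly Q a) (at r)"
    unfolding r by (intro tendsto_intros)
  have tP: "((\<lambda>x::real. poly P (of_real x)) \<longlongrightarrow> poly P a) (at r)"
    unfolding r by (intro tendsto_intros)
  have Qa: "poly Q a \<noteq> 0" using Q Some by simp
  have "((\<lambda>x::real. poly P (of_real x) / poly Q (of_real x)) \<longlongrightarrow> poly P a / poly Q a) (at r)"
    by (rule tendsto_divide[OF tP tQ Qa])
  moreover have "\<forall>\<^sub>F x::real in at r. poly P (of_real x) / poly Q (of_real x)
      = rf_eval (Fract P Q) (Some (of_real x))"
    using tendsto_imp_eventually_ne[OF tQ Qa]
    by eventually_elim (simp add: rf_eval_Fract[OF P Q(1)])
  ultimately have "((\<lambda>x. rf_eval (Fract P Q) (Some (of_real x))) \<longlongrightarrow> poly P a / poly Q a) (at r)"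
    by (rule Lim_transform_eventually)
  then show ?thesis using rf_eval_Fract[OF P Q] Some r by (simp add: real_approach_def)
next
  case None
  then have Qn: "coeff Q n \<noteq> 0" using Q by simp
  have tQ: "((\<lambda>x::real. poly Q (of_real x) / of_real x ^ n) \<longlongrightarrow> coeff Q n) at_infinity"
    by (rule poly_over_power_at_infinity[OF Q(1)])
  have "((\<lambda>x::real. (poly P (of_real x) / of_real x ^ n) / (poly Q (of_real x) / of_real x ^ n))
      \<longlongrightarrow> coeff P n / coeff Q n) at_infinity"
    by (rule tendsto_divide[OF poly_over_power_at_infinity[OF P] tQ Qn])
  moreover have "\<forall>\<^sub>F x::real in at_infinity.
      (poly P (of_real x) / of_real x ^ n) / (poly Q (of_real x) / of_real x ^ n)
      = rf_eval (Fract P Q) (Some (of_real x))"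
    using tendsto_imp_eventually_ne[OF tQ Qn] eventually_not_equal_at_infinity[of 0]
    by eventually_elim (simp add: rf_eval_Fract[OF P Q(1)])
  ultimately have "((\<lambda>x. rf_eval (Fract P Q) (Some (of_real x))) \<longlongrightarrow> coeff P n / coeff Q n) at_infinity"
    by (rule Lim_transform_eventually)
  then show ?thesis using rf_eval_Fract[OF P Q] None by (simp add: real_approach_def)
qed

lemma extremal_functional_regular:
  assumes D: "is_divisor D" "\<forall>p. D p \<ge> 0" and p: "p \<in> ext_real" "D p = 0" and F: "F \<in> Lspace D"
  shows "extremal_functional p 0 F = Re (rf_eval F p)"
proof -
  define n where "n = nat (div_degree D)"
  have "div_degree D \<ge> 0"
    unfolding div_degree_def by (rule sum_nonneg) (use D(2) in blast)
  then have n: "div_degree D = int n" by (simp add: n_def)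
  obtain P where P: "degree P \<le> n" "F = Fract P (div_den D)"
    by (rule Lspace_Fract[OF D n F])
  have "degree (div_den D) \<le> n" using degree_div_den[OF D] n spec[OF D(2), of None] by linarith
  then have "((\<lambda>x. rf_eval F (Some (of_real x))) \<longlongrightarrow> rf_eval F p) (real_approach p)"
    unfolding P(2) using hev_div_den_nonzero_iff[OF D n, of p] p P(1) by (intro tendsto_rf_eval) auto
  then show ?thesis unfolding extremal_functional_def by (simp add: tendsto_Lim)
qed

lemma rf_eval_rconst: "rf_eval (rconst c) p = c"
  unfolding rconst_def by (subst rf_eval_Fract[of _ 0]) (auto simp: hev_def split: option.split)

lemma rconst_in_Lspace: "\<forall>p. D p \<ge> 0 \<Longrightarrow> rconst c \<in> Lspace D"
  unfolding rconst_def by (rule Fract_in_Lspace) auto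

text \<open>A constant is divided by a positive power of a function with a pole at
  \<open>p\<close>.\<close>

lemma extremal_functional_rconst:
  assumes "p \<in> ext_real" "d > 0"
  shows "extremal_functional p d (rconst c) = 0"
proof -
  have "((\<lambda>x::real. inverse (rfun (of_real x) p)) \<longlongrightarrow> 0) (real_approach p)"
  proof (cases p)
    case None
    then show ?thesis
      using tendsto_of_real[OF tendsto_inverse_0[where 'a = real], where 'a = complex]
      by (simp add: rfun_def real_approach_def)
  next
    case (Some a)
    then obtain r where r: "a = of_real r" using assms by (auto simp: ext_real_def elim!: Reals_cases)
    have "((\<lambda>x::real. a - of_real x) \<longlongrightarrow> a - of_real r) (at r)" by (intro tendsto_intros)
    then show ?thesis using Some r by (simp add: rfun_def real_approach_def)
  qed
  then have "((\<lambda>x::real. c * inverse (rfun (of_real x) p) ^ d) \<longlongrightarrow> c * 0 ^ d) (real_approach p)"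
    by (intro tendsto_intros)
  then have "((\<lambda>x::real. c / rfun (of_real x) p ^ d) \<longlongrightarrow> 0) (real_approach p)"
    using assms(2) by (simp add: divide_inverse power_inverse zero_power)
  then show ?thesis unfolding extremal_functional_def rf_eval_rconst by (simp add: tendsto_Lim)
qed

text \<open>The squared ratio is \<open>chi p p e / chi q q e\<close>, as the weights cancel, so the
  bounds come from compactness. The lower bound needs \<open>p\<close> to stay away from
  \<open>E\<close> as well.\<close>

lemma br_ratio_bounds:
  assumes E: "compactin sphere_top E" and q: "q \<notin> E"
  obtains \<delta> M where "0 < M" "p \<notin> E \<Longrightarrow> 0 < \<delta>"
    "\<And>e. e \<in> E \<Longrightarrow> norm (br e p / br e q) \<le> M"
    "\<And>e. e \<in> E \<Longrightarrow> p \<notin> E \<Longrightarrow> \<delta> \<le> norm (br e p / br e q)"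
proof -
  obtain d M where d: "0 < d" "\<And>e. e \<in> E \<Longrightarrow> d \<le> chi q q e" "\<And>e. e \<in> E \<Longrightarrow> chi q q e \<le> M"
    using chi_bounds[OF E q] by metis
  have "compact (chi p p ` E)"
    using image_compactin[OF E continuous_map_chi] by simp
  then obtain N where N: "\<And>e. e \<in> E \<Longrightarrow> chi p p e \<le> N"
    by (metis compact_imp_bounded bounded_imp_bdd_above bdd_above.E imageI)
  obtain d' where d': "p \<notin> E \<Longrightarrow> 0 < d'" "\<And>e. e \<in> E \<Longrightarrow> p \<notin> E \<Longrightarrow> d' \<le> chi p p e"
    using chi_bounds[OF E, of p] by (metis (full_types))
  have sq: "(norm (br e p / br e q))\<^sup>2 = chi p p e / chi q q e" for e
    using less_imp_neq[OF wt_pos[of e]] by (simp add: chi_self norm_divide power_divide)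
  \<comment> \<open>The added 1 keeps the upper bound strictly positive, and the absolute values
    cover an empty \<open>E\<close>.\<close>
  show ?thesis
  proof (rule that[of "sqrt (\<bar>N\<bar> / d) + 1" "sqrt (d' / (\<bar>M\<bar> + 1))"])
    fix e assume e: "e \<in> E"
    have "chi p p e / chi q q e \<le> \<bar>N\<bar> / d"
      using d(1) d(2)[OF e] N[OF e] by (intro frac_le) auto
    then have "norm (br e p / br e q) \<le> sqrt (\<bar>N\<bar> / d)"
      unfolding sq[symmetric] by (rule real_le_rsqrt)
    then show "norm (br e p / br e q) \<le> sqrt (\<bar>N\<bar> / d) + 1" by simp
    show "sqrt (d' / (\<bar>M\<bar> + 1)) \<le> norm (br e p / br e q)" if "p \<notin> E"
    proof (rule real_le_lsqrt)
      show "d' / (\<bar>M\<bar> + 1) \<le> (norm (br e p / br e q))\<^sup>2"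
        unfolding sq using d(1) d(2,3)[OF e] d'(1)[OF that] d'(2)[OF e that] by (intro frac_le) auto
    qed simp
  qed (use d(1) d'(1) in \<open>auto intro: add_nonneg_pos\<close>)
qed

text \<open>The competitor is a small positive multiple of the \<open>d\<close>-th power of
  \<open>rfun\<close>, whose functional is that multiple.\<close>

lemma power_competitor:
  assumes E: "compactin sphere_top E" "p \<in> ext_real" "p \<notin> E" and D: "\<forall>p. D p \<ge> 0" "D p = int d"
  obtains G where "admissible E D G" "extremal_functional p d G > 0"
proof -
  \<comment> \<open>\<open>q\<close> is the zero of \<open>rfun\<close> with pole \<open>p\<close>;
    up to the sign \<open>s\<close>, \<open>rfun\<close> is the quotient of the brackets with
    \<open>q\<close> and \<open>p\<close>.\<close>
  define q where "q = (if p = None then Some 0 else None :: complex option)"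
  define s where "s = (if p = None then -1 else 1 :: complex)"
  have r: "rfun z p = s * (br (Some z) q / br (Some z) p)" for z
    by (cases p) (simp_all add: rfun_def s_def q_def minus_divide_right)
  obtain M where M: "0 < M" "\<And>e. e \<in> E \<Longrightarrow> norm (br e q / br e p) \<le> M"
    using br_ratio_bounds[OF E(1,3), of q] by metis
  define \<epsilon> where "\<epsilon> = 1 / M ^ d"
  define G where "G = Fract (smult (of_real \<epsilon> * s ^ d) (lin q ^ d)) (lin p ^ d)"
  have \<epsilon>: "\<epsilon> > 0" using M by (simp add: \<epsilon>_def)
  have lin1: "degree (lin x) \<le> 1" for x by (simp add: degree_lin)
  have hp: "degree (lin x ^ k) \<le> k \<and> hev k (lin x ^ k) y = br y x ^ k" for k x y
  proof (induction k)
    case 0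
    then show ?case by (cases y) simp_all
  next
    case (Suc k)
    have "degree (lin x * lin x ^ k) \<le> Suc k"
      using degree_mult_le[of "lin x" "lin x ^ k"] Suc lin1[of x] by linarith
    moreover have "hev (1 + k) (lin x * lin x ^ k) y = hev 1 (lin x) y * hev k (lin x ^ k) y"
      using Suc lin1 by (intro hev_mult) auto
    ultimately show ?case using Suc by (simp add: br_def)
  qed
  have Gev: "rf_eval G y = of_real \<epsilon> * (s * (br y q / br y p)) ^ d" if "y \<noteq> p" for y
  proof -
    have "rf_eval G y = hev d (smult (of_real \<epsilon> * s ^ d) (lin q ^ d)) y / hev d (lin p ^ d) y"
      unfolding G_def using hp that
      by (intro rf_eval_Fract) (auto intro: order_trans[OF degree_smult_le])
    then show ?thesis using hp by (simp add: hev_smult power_mult_distrib power_divide)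
  qed
  have "G \<in> Lspace D"
    unfolding G_def
  proof (rule Fract_in_Lspace)
    fix a
    show "int (order a (lin p ^ d)) \<le> D (Some a)"
    proof (cases "p = Some a")
      case True
      then show ?thesis using D by (simp add: lin_def order_power_n_n)
    next
      case False
      then have "poly (lin p ^ d) a \<noteq> 0" by (cases p) (auto simp: lin_def)
      then show ?thesis using D by (simp add: order_0I)
    qed
  next
    have "degree (smult (of_real \<epsilon> * s ^ d) (lin q ^ d)) \<le> d"
      using hp by (intro order_trans[OF degree_smult_le]) auto
    moreover have "int (degree (lin p ^ d)) + D None \<ge> int d"
      using D by (cases p) (auto simp: degree_power_eq degree_lin)
    ultimately show "int (degree (smult (of_real \<epsilon> * s ^ d) (lin q ^ d))) \<le> int (degree (lin p ^ d)) + D None"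
      by linarith
  qed (use D in auto)
  moreover have "norm (rf_eval G e) \<le> 1" if "e \<in> E" for e
  proof -
    have "norm (rf_eval G e) = \<epsilon> * norm (br e q / br e p) ^ d"
      using that E(3) \<epsilon> by (subst Gev) (auto simp: norm_mult norm_power s_def)
    also have "\<dots> \<le> \<epsilon> * M ^ d"
      using \<epsilon> M(2)[OF that] by (intro mult_left_mono power_mono) auto
    finally show ?thesis using M(1) by (simp add: \<epsilon>_def)
  qed
  moreover have "extremal_functional p d G = \<epsilon>"
  proof -
    \<comment> \<open>For \<open>p\<close> at infinity \<open>rfun\<close> is the coordinate itself,
      so 0 must be avoided before dividing.\<close>
    have "\<forall>\<^sub>F x in real_approach p. x \<noteq> 0 \<or> p \<noteq> None"
      using eventually_not_equal_at_infinity[of "0::real"] by (cases p) (simp_all add: real_approach_def)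
    with eventually_real_approach[OF E(2)]
    have "\<forall>\<^sub>F x in real_approach p. of_real \<epsilon> =
        rf_eval G (Some (of_real x)) / rfun (of_real x) p ^ d"
    proof eventually_elim
      case (elim x)
      then have "rfun (of_real x) p \<noteq> 0" by (cases p) (auto simp: rfun_def)
      then show ?case using Gev[of "Some (of_real x)"] elim(1) r[of "of_real x"] by simp
    qed
    then have "((\<lambda>x. rf_eval G (Some (of_real x)) / rfun (of_real x) p ^ d) \<longlongrightarrow> of_real \<epsilon>) (real_approach p)"
      by (rule Lim_transform_eventually[OF tendsto_const])
    then show ?thesis unfolding extremal_functional_def by (simp add: tendsto_Lim)
  qed
  ultimately show ?thesis using that[of G] \<epsilon> by (simp add: admissible_def)
qed

text \<open>The function \<open>1 + \<kappa> (\<delta> + A / B)\<close> works: on \<open>E\<close>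
  the bracketed term is at most 0, while at \<open>p\<close> the numerator \<open>A\<close> vanishes
  and leaves \<open>1 + \<kappa> \<delta>\<close>.\<close>

lemma bump_competitor:
  assumes A: "degree A \<le> m" and B: "degree B \<le> m" "B \<noteq> 0" "hev m A p = 0" "hev m B p \<noteq> 0"
    and D: "\<forall>p. D p \<ge> 0" "\<And>a. int (order a B) \<le> D (Some a)" "int m \<le> int (degree B) + D None"
    and \<delta>: "\<delta> > 0" "M > 0"
    and E: "\<And>e. e \<in> E \<Longrightarrow> hev m B e \<noteq> 0 \<and> (\<exists>h. hev m A e / hev m B e = of_real h \<and> -M \<le> h \<and> h \<le> -\<delta>)"
  obtains G where "admissible E D G" "Re (rf_eval G p) > 1"
proof -
  \<comment> \<open>This scale keeps the values on \<open>E\<close> between 0 and 1.\<close>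
  define \<kappa> where "\<kappa> = 1 / M"
  have \<kappa>: "\<kappa> > 0" using \<delta> by (simp add: \<kappa>_def)
  define N where "N = smult (of_real (1 + \<kappa> * \<delta>)) B + smult (of_real \<kappa>) A"
  define G where "G = Fract N B"
  have N: "degree N \<le> m"
    unfolding N_def using A B by (intro degree_add_le order_trans[OF degree_smult_le])
  have ev: "rf_eval G y = of_real (1 + \<kappa> * \<delta>) + of_real \<kappa> * (hev m A y / hev m B y)" if "hev m B y \<noteq> 0" for y
    unfolding G_def using that
    by (subst rf_eval_Fract[OF N B(1) that]) (simp add: N_def hev_add hev_smult add_divide_distrib)
  have "G \<in> Lspace D"
    unfolding G_def by (rule Fract_in_Lspace) (use D B N in auto)
  moreover have "norm (rf_eval G e) \<le> 1" if e: "e \<in> E" for e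
  proof -
    obtain h where h: "hev m A e / hev m B e = of_real h" "-M \<le> h" "h \<le> -\<delta>" using E[OF e] by blast
    have "rf_eval G e = of_real (1 + \<kappa> * (h + \<delta>))"
      using E[OF e] by (subst ev) (simp_all add: h(1) algebra_simps)
    moreover have "\<kappa> * (h + \<delta>) \<le> 0" using h \<kappa> by (simp add: mult_le_0_iff)
    moreover have "\<kappa> * (h + \<delta>) \<ge> -1" using h \<delta> by (simp add: \<kappa>_def field_simps)
    ultimately show ?thesis by (simp only: norm_of_real)
  qed
  moreover have "Re (rf_eval G p) > 1"
    using ev[OF B(4)] B(3) \<kappa> \<delta> by simp
  ultimately show ?thesis using that by (auto simp: admissible_def)
qed

lemma same_gap_pole_competitor:
  assumes E: "E \<subseteq> ext_real" "compactin sphere_top E" and p: "p \<in> ext_real - E" and c: "c \<in> ext_real - E"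
    and gap: "same_gap E p c" "p \<noteq> c" and D: "\<forall>p. D p \<ge> 0" "D c \<ge> 1"
  obtains G where "admissible E D G" "Re (rf_eval G p) > 1"
proof (cases "E = {}")
  case True
  show ?thesis
  proof (rule that[of "rconst 2"])
  qed (use True in \<open>auto simp: admissible_def rconst_in_Lspace D rf_eval_rconst\<close>)
next
  case False
  then obtain e0 where e0: "e0 \<in> E" by auto
  \<comment> \<open>By \<open>same_gap_sign\<close> the sign at the sample point \<open>e0\<close>
    is the sign on all of \<open>E\<close>; negating it makes the quotient negative on
    \<open>E\<close>.\<close>
  define \<sigma> where "\<sigma> = - sgn (Re (br e0 p * br e0 c))"
  obtain \<delta> M where b: "0 < M" "0 < \<delta>" "\<And>e. e \<in> E \<Longrightarrow> norm (br e p / br e c) \<le> M"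
    "\<And>e. e \<in> E \<Longrightarrow> \<delta> \<le> norm (br e p / br e c)"
    using br_ratio_bounds[OF E(2), of c p] p c by (metis DiffD2)
  show ?thesis
  proof (rule bump_competitor[of "smult (of_real \<sigma>) (lin p)" 1 "lin c" p D \<delta> M E, OF _ _ _ _ _ D(1)])
    show "int (order a (lin c)) \<le> D (Some a)" for a
      using D by (auto simp: order_lin)
    show "int 1 \<le> int (degree (lin c)) + D None" using D by (auto simp: degree_lin)
    fix e assume e: "e \<in> E"
    obtain x y where xy: "br e p = of_real x" "br e c = of_real y"
      using br_real[of e p] br_real[of e c] e E p c by (auto elim!: Reals_cases)
    have nz: "y \<noteq> 0" using xy c e by force
    have "Re (br e0 p * br e0 c) * (x * y) > 0"
      using same_gap_sign[OF E(1) gap(1) e0 e] by (simp add: xy)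
    then have \<sigma>: "\<sigma> = - (sgn x * sgn y)"
      unfolding \<sigma>_def sgn_mult[symmetric] by (metis mult_less_0_iff not_less_iff_gr_or_eq sgn_real_def zero_less_mult_iff)
    have "\<sigma> * x / y = - \<bar>x / y\<bar>"
      using nz unfolding \<sigma> by (simp add: abs_sgn sgn_divide field_simps)
    then have "hev 1 (smult (of_real \<sigma>) (lin p)) e / hev 1 (lin c) e = of_real (- \<bar>x / y\<bar>)"
      unfolding hev_smult br_def[symmetric] xy
      by (metis of_real_divide of_real_mult)
    moreover have "\<delta> \<le> \<bar>x / y\<bar>" "\<bar>x / y\<bar> \<le> M"
      using b(3,4)[OF e] by (simp_all add: xy norm_divide)
    moreover have "hev 1 (lin c) e \<noteq> 0"
      unfolding br_def[symmetric] using e c by auto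
    ultimately show "hev 1 (lin c) e \<noteq> 0 \<and> (\<exists>h. hev 1 (smult (of_real \<sigma>) (lin p)) e / hev 1 (lin c) e = of_real h
        \<and> -M \<le> h \<and> h \<le> -\<delta>)" by (intro conjI exI[of _ "- \<bar>x / y\<bar>"]) auto
  qed (use gap b that in \<open>auto simp: degree_lin hev_smult br_def[symmetric] simp del: One_nat_def\<close>)
qed

text \<open>The squared numerator contributes no sign, so the gap shared by \<open>c\<close> and
  \<open>c'\<close> decides it. The last hypothesis on \<open>D\<close> counts multiplicity, which
  includes the double pole \<open>c = c'\<close>.\<close>

lemma pole_pair_competitor:
  assumes E: "E \<subseteq> ext_real" "compactin sphere_top E" and p: "p \<in> ext_real - E"
    and c: "c \<in> ext_real - E" "c' \<in> ext_real - E"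
    and gap: "same_gap E c c'" "p \<noteq> c" "p \<noteq> c'"
    and D: "\<forall>p. D p \<ge> 0" "\<And>q. (if q = c then 1 else 0) + (if q = c' then 1 else 0) \<le> D q"
  obtains G where "admissible E D G" "Re (rf_eval G p) > 1"
proof (cases "E = {}")
  case True
  show ?thesis
  proof (rule that[of "rconst 2"])
  qed (use True in \<open>auto simp: admissible_def rconst_in_Lspace D rf_eval_rconst\<close>)
next
  case False
  then obtain e0 where e0: "e0 \<in> E" by auto
  define \<sigma> where "\<sigma> = - sgn (Re (br e0 c * br e0 c'))"
  obtain \<delta> M where b: "0 < M" "0 < \<delta>" "\<And>e. e \<in> E \<Longrightarrow> norm (br e p / br e c) \<le> M"
    "\<And>e. e \<in> E \<Longrightarrow> \<delta> \<le> norm (br e p / br e c)"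
    using br_ratio_bounds[OF E(2), of c p] p c by (metis DiffD2)
  obtain \<delta>' M' where b': "0 < M'" "0 < \<delta>'" "\<And>e. e \<in> E \<Longrightarrow> norm (br e p / br e c') \<le> M'"
    "\<And>e. e \<in> E \<Longrightarrow> \<delta>' \<le> norm (br e p / br e c')"
    using br_ratio_bounds[OF E(2), of c' p] p c by (metis DiffD2)
  have h2: "hev 2 (lin x * lin y) z = br z x * br z y" for x y z
    using hev_mult[of "lin x" 1 "lin y" 1 z] by (simp add: degree_lin br_def numeral_2_eq_2)
  have d2: "degree (lin x * lin y) \<le> 2" for x y
    using degree_mult_le[of "lin x" "lin y"] by (auto simp: degree_lin split: if_splits)
  show ?thesis
  proof (rule bump_competitor[of "smult (of_real \<sigma>) (lin p * lin p)" 2 "lin c * lin c'" p D "\<delta> * \<delta>'" "M * M'" E, OF _ _ _ _ _ D(1)])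
    show "int (order a (lin c * lin c')) \<le> D (Some a)" for a
      using D(2)[of "Some a"] by (auto simp: order_mult order_lin split: if_splits)
    show "int 2 \<le> int (degree (lin c * lin c')) + D None"
      using D(2)[of None] by (auto simp: degree_mult_eq degree_lin split: if_splits)
    fix e assume e: "e \<in> E"
    obtain x y y' where xy: "br e p = of_real x" "br e c = of_real y" "br e c' = of_real y'"
      using br_real[of e p] br_real[of e c] br_real[of e c'] e E p c by (auto elim!: Reals_cases)
    have nz: "y \<noteq> 0" "y' \<noteq> 0" using xy c e by force+
    have "Re (br e0 c * br e0 c') * (y * y') > 0"
      using same_gap_sign[OF E(1) gap(1) e0 e] by (simp add: xy)
    then have \<sigma>: "\<sigma> = - sgn (y * y')"
      unfolding \<sigma>_def by (metis mult_less_0_iff not_less_iff_gr_or_eq sgn_real_def zero_less_mult_iff)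
    have "\<sigma> * (x * x) / (y * y') = - (\<bar>x / y\<bar> * \<bar>x / y'\<bar>)"
    proof -
      have "sgn (y * y') / (y * y') = 1 / \<bar>y * y'\<bar>"
        using nz by (simp add: sgn_if abs_if)
      then have "sgn (y * y') * (x * x) / (y * y') = (x * x) / \<bar>y * y'\<bar>"
        by (metis mult.commute mult.right_neutral times_divide_eq_right)
      then show ?thesis unfolding \<sigma> by (simp add: abs_mult)
    qed
    then have "hev 2 (smult (of_real \<sigma>) (lin p * lin p)) e / hev 2 (lin c * lin c') e
        = of_real (- (\<bar>x / y\<bar> * \<bar>x / y'\<bar>))"
      unfolding hev_smult h2 xy
      by (metis of_real_divide of_real_mult)
    moreover have "\<delta> \<le> \<bar>x / y\<bar>" "\<bar>x / y\<bar> \<le> M" "\<delta>' \<le> \<bar>x / y'\<bar>" "\<bar>x / y'\<bar> \<le> M'"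
      using b(3,4)[OF e] b'(3,4)[OF e] by (simp_all add: xy norm_divide)
    then have "\<delta> * \<delta>' \<le> \<bar>x / y\<bar> * \<bar>x / y'\<bar>" "\<bar>x / y\<bar> * \<bar>x / y'\<bar> \<le> M * M'"
      using b b' by (intro mult_mono; simp)+
    moreover have "hev 2 (lin c * lin c') e \<noteq> 0"
      unfolding h2 using e c by auto
    ultimately show "hev 2 (lin c * lin c') e \<noteq> 0 \<and>
        (\<exists>h. hev 2 (smult (of_real \<sigma>) (lin p * lin p)) e / hev 2 (lin c * lin c') e = of_real h
        \<and> -(M * M') \<le> h \<and> h \<le> -(\<delta> * \<delta>'))" by (intro conjI exI[of _ "- (\<bar>x / y\<bar> * \<bar>x / y'\<bar>)"]) auto
  qed (use gap b b' that d2 in \<open>auto simp: hev_smult h2\<close>)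
qed

section \<open>Separated gaps\<close>

lemma phi_inj:
  assumes "p \<in> ext_real" "q \<in> ext_real" "r \<in> ext_real" "q \<noteq> p" "r \<noteq> p" "phi p q = phi p r"
  shows "q = r"
  using psi_phi[OF assms(1,2,4)] psi_phi[OF assms(1,3,5)] assms(6) by metis

text \<open>In the coordinate \<open>phi p\<close> the poles are \<open>n\<close> distinct reals,
  cutting the line into \<open>n + 1\<close> intervals. Each interval meets \<open>E\<close>, since
  otherwise two poles, or a pole and \<open>p\<close>, would share a gap.\<close>

lemma interlacing_points:
  assumes p: "p \<in> ext_real - E" and E: "E \<subseteq> ext_real"
    and c: "\<forall>k\<in>{1..n}. c k \<in> ext_real - E" "\<forall>k\<in>{1..n}. \<not> same_gap E p (c k)"
      "\<forall>j\<in>{1..n}. \<forall>k\<in>{1..n}. j \<noteq> k \<longrightarrow> \<not> same_gap E (c j) (c k)"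
    and cp: "\<forall>k\<in>{1..n}. c k \<noteq> p" and inj: "inj_on c {1..n}"
    and ne: "E \<noteq> {}"
  obtains s \<tau> :: "nat \<Rightarrow> real" where
    "\<And>k. k < n \<Longrightarrow> psi p (\<tau> k) \<in> c ` {1..n}"
    "\<And>j. j \<le> n \<Longrightarrow> psi p (s j) \<in> E"
    "\<And>j k. j \<le> k \<Longrightarrow> k < n \<Longrightarrow> s j < \<tau> k" "\<And>j k. k < j \<Longrightarrow> j \<le> n \<Longrightarrow> \<tau> k < s j"
proof -
  define C where "C = (\<lambda>k. phi p (c k)) ` {1..n}"
  have "inj_on (\<lambda>k. phi p (c k)) {1..n}"
  proof (rule inj_onI)
    fix j k assume "j \<in> {1..n}" "k \<in> {1..n}" "phi p (c j) = phi p (c k)"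
    then show "j = k" using phi_inj[of p "c j" "c k"] p c(1) cp inj by (auto dest: inj_onD)
  qed
  then have cardC: "card C = n" by (simp add: C_def card_image)
  have psiC: "psi p t \<in> c ` {1..n}" if "t \<in> C" for t
    using that psi_phi[of p] p c(1) cp by (auto simp: C_def)
  define \<tau> where "\<tau> k = sorted_list_of_set C ! k" for k
  have fin: "finite C" by (simp add: C_def)
  have len: "length (sorted_list_of_set C) = n" using cardC by simp
  have \<tau>C: "\<tau> k \<in> C" if "k < n" for k
    using that len fin nth_mem[of k "sorted_list_of_set C"] by (simp add: \<tau>_def)
  have \<tau>less: "\<tau> i < \<tau> k" if "i < k" "k < n" for i k
    using sorted_wrt_nth_less[OF strict_sorted_list_of_set, of i k C] that len
    by (simp add: \<tau>_def)
  have \<tau>le: "\<tau> i \<le> \<tau> k" if "i \<le> k" "k < n" for i k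
    using \<tau>less[of i k] that by (cases "i = k") auto
  have gap: "\<not> same_gap E (psi p (\<tau> i)) (psi p (\<tau> k))" if ik: "i < k" "k < n" for i k
  proof -
    have "psi p (\<tau> i) \<in> c ` {1..n}" "psi p (\<tau> k) \<in> c ` {1..n}"
      using psiC \<tau>C ik by auto
    then obtain a b where ab: "a \<in> {1..n}" "b \<in> {1..n}" "psi p (\<tau> i) = c a" "psi p (\<tau> k) = c b"
      by auto
    have "a \<noteq> b" using ab \<tau>less[OF ik] by (metis phi_psi less_irrefl)
    then show ?thesis using ab c(3) by simp
  qed
  have gapp: "\<not> same_gap E p (psi p (\<tau> k))" if "k < n" for k
    using psiC[OF \<tau>C[OF that]] c(2) by auto
  have nE: "psi p (\<tau> k) \<notin> E" if "k < n" for k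
    using psiC[OF \<tau>C[OF that]] c(1) by auto
  have "\<exists>t. psi p t \<in> E \<and> (\<forall>k<n. (j \<le> k \<longrightarrow> t < \<tau> k) \<and> (k < j \<longrightarrow> \<tau> k < t))" if j: "j \<le> n" for j
  proof -
    have pick: "\<exists>t. psi p t \<in> E \<and> t \<in> S" if "\<not> (\<forall>t\<in>S. psi p t \<notin> E)" for S :: "real set"
      using that by blast
    \<comment> \<open>Poles lie outside \<open>E\<close>, so weak inequalities become
      strict.\<close>
    have ends: "t < \<tau> k" if "psi p t \<in> E" "t \<le> \<tau> k" "k < n" for t k
      using that nE[of k] by (cases "t = \<tau> k") auto
    have ends': "\<tau> k < t" if "psi p t \<in> E" "\<tau> k \<le> t" "k < n" for t k
      using that nE[of k] by (cases "t = \<tau> k") auto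
    consider "n = 0" | "j = 0" "n > 0" | "j = n" "n > 0" | "0 < j" "j < n" using j by linarith
    then show ?thesis
    proof cases
      case 1
      obtain e where "e \<in> E" using ne by auto
      then have "psi p (phi p e) = e" using p E by (intro psi_phi) auto
      then show ?thesis using 1 \<open>e \<in> E\<close> by (intro exI[of _ "phi p e"]) auto
    next
      case 2
      \<comment> \<open>A ray missing \<open>E\<close> would put the outermost pole into the gap of
        \<open>p\<close>; the right end is handled in the same way.\<close>
      have "\<not> (\<forall>t\<in>{..\<tau> 0}. psi p t \<notin> E)"
        using same_gap_ray[of p E "{..\<tau> 0}" "\<tau> 0"] gapp[of 0] p 2 by auto
      from pick[OF this] obtain t where "psi p t \<in> E" "t \<le> \<tau> 0" by auto
      then have "psi p t \<in> E \<and> t < \<tau> 0" using ends 2 by blast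
      then show ?thesis using \<tau>le[of 0] 2 by (intro exI[of _ t]) force
    next
      case 3
      have "\<not> (\<forall>t\<in>{\<tau> (n - 1)..}. psi p t \<notin> E)"
        using same_gap_ray[of p E "{\<tau> (n - 1)..}" "\<tau> (n - 1)"] gapp[of "n - 1"] p 3 by auto
      from pick[OF this] obtain t where "psi p t \<in> E" "\<tau> (n - 1) \<le> t" by auto
      then have "psi p t \<in> E \<and> \<tau> (n - 1) < t" using ends' 3 by simp
      moreover have "\<tau> k \<le> \<tau> (n - 1)" if "k < n" for k using \<tau>le[of k "n - 1"] that by simp
      ultimately show ?thesis using 3 by (intro exI[of _ t]) force
    next
      case 4
      have "\<not> (\<forall>t\<in>{\<tau> (j - 1)..\<tau> j}. psi p t \<notin> E)"
      proof
        assume H: "\<forall>t\<in>{\<tau> (j - 1)..\<tau> j}. psi p t \<notin> E"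
        have "\<tau> (j - 1) \<le> \<tau> j" by (rule \<tau>le) (use 4 in auto)
        then have "same_gap E (psi p (\<tau> (j - 1))) (psi p (\<tau> j))"
          by (rule same_gap_arc[rotated]) (use H p in auto)
        then show False using gap[of "j - 1" j] 4 by simp
      qed
      from pick[OF this] obtain t where "psi p t \<in> E" "\<tau> (j - 1) \<le> t" "t \<le> \<tau> j" by auto
      then have t: "psi p t \<in> E" "\<tau> (j - 1) < t" "t < \<tau> j" using ends ends' 4 by auto
      moreover have "\<tau> k \<le> \<tau> (j - 1)" if "k < j" for k using \<tau>le[of k "j - 1"] that 4 by simp
      moreover have "\<tau> j \<le> \<tau> k" if "j \<le> k" "k < n" for k using \<tau>le that by simp
      ultimately show ?thesis by (intro exI[of _ t]) (meson le_less_trans less_le_trans)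
    qed
  qed
  then obtain s where "\<And>j. j \<le> n \<Longrightarrow> psi p (s j) \<in> E \<and> (\<forall>k<n. (j \<le> k \<longrightarrow> s j < \<tau> k) \<and> (k < j \<longrightarrow> \<tau> k < s j))"
    by metis
  then show ?thesis using that[of \<tau> s] psiC \<tau>C by auto
qed

text \<open>With \<open>p\<close> moved to infinity, the interlacing principle identifies the
  transformed numerator and denominator of \<open>F\<close>; the identity is then carried back to
  \<open>P = Q\<close>.\<close>

lemma separated_gaps_rigid:
  assumes p: "p \<in> ext_real - E" and E: "E \<subseteq> ext_real" "E \<noteq> {}"
    and D: "is_divisor D" "\<forall>p. D p \<ge> 0" "div_degree D = int n" "D p = 0"
    and c: "\<forall>k\<in>{1..n}. c k \<in> ext_real - E" "\<forall>k\<in>{1..n}. \<not> same_gap E p (c k)"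
      "\<forall>j\<in>{1..n}. \<forall>k\<in>{1..n}. j \<noteq> k \<longrightarrow> \<not> same_gap E (c j) (c k)"
    and cD: "\<forall>k\<in>{1..n}. D (c k) > 0" and inj: "inj_on c {1..n}"
    and DE: "\<forall>e\<in>E. D e = 0"
    and F: "admissible E D F" "Re (rf_eval F p) \<ge> 1"
  shows "F = rconst 1"
proof -
  have F': "F \<in> Lspace D" "\<And>e. e \<in> E \<Longrightarrow> norm (rf_eval F e) \<le> 1" using F by (auto simp: admissible_def)
  define Q where "Q = div_den D"
  obtain P where P: "degree P \<le> n" "F = Fract P Q"
    unfolding Q_def by (rule Lspace_Fract[OF D(1-3) F'(1)])
  have Q: "degree Q \<le> n" using degree_div_den[OF D(1,2)] D(3) spec[OF D(2), of None] by (simp add: Q_def)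
  have Qnz: "hev n Q y \<noteq> 0 \<longleftrightarrow> D y = 0" for y
    unfolding Q_def by (rule hev_div_den_nonzero_iff[OF D(1-3)])
  have ev: "rf_eval F y = hev n P y / hev n Q y" if "D y = 0" for y
    unfolding P(2) using that Qnz by (intro rf_eval_Fract P Q) auto
  have pE: "p \<in> ext_real" using p by auto
  obtain T \<kappa> where T: "\<And>P. degree P \<le> n \<Longrightarrow> degree (T P) \<le> n"
    "\<And>P. degree P \<le> n \<Longrightarrow> coeff (T P) n = hev n P p"
    "\<And>P t. degree P \<le> n \<Longrightarrow> poly (T P) (of_real t) = \<kappa> t * hev n P (psi p t)"
    "\<And>t. \<kappa> t \<noteq> 0"
    by (rule moved_to_infinity[OF pE, of n]) blast
  have cp: "\<forall>k\<in>{1..n}. c k \<noteq> p" using cD D(4) by force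
  obtain s \<tau> where st: "\<And>k. k < n \<Longrightarrow> psi p (\<tau> k) \<in> c ` {1..n}"
    "\<And>j. j \<le> n \<Longrightarrow> psi p (s j) \<in> E"
    "\<And>j k. j \<le> k \<Longrightarrow> k < n \<Longrightarrow> s j < \<tau> k" "\<And>j k. k < j \<Longrightarrow> j \<le> n \<Longrightarrow> \<tau> k < s j"
    by (rule interlacing_points[OF p E(1) c cp inj E(2)]) blast
  have TPQ: "T P = T Q"
  proof (rule interlacing_maximum_principle[of n s \<tau>])
    show "coeff (T Q) n \<noteq> 0" using T(2)[OF Q] Qnz D(4) by simp
    show "poly (T Q) (of_real (\<tau> k)) = 0" if k: "k < n" for k
    proof -
      have "D (psi p (\<tau> k)) \<noteq> 0" using st(1)[OF k] cD by force
      then show ?thesis using T(3)[OF Q] Qnz by (metis mult_zero_right)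
    qed
    show "norm (poly (T P) (of_real (s j)) / poly (T Q) (of_real (s j))) \<le> 1" if j: "j \<le> n" for j
      using F'(2)[OF st(2)[OF j]] ev[of "psi p (s j)"] DE st(2)[OF j] T(3)[OF Q] T(3)[OF P(1)] T(4)
      by simp
    show "1 \<le> Re (coeff (T P) n / coeff (T Q) n)"
      using F(2) ev[OF D(4)] T(2)[OF Q] T(2)[OF P(1)] by simp
  qed (use T P Q st in auto)
  \<comment> \<open>Since \<open>\<kappa>\<close> never vanishes, the transformed identity can be
    read at every real point other than \<open>p\<close>; these are infinitely many.\<close>
  have eq: "poly P z = poly Q z" if z: "z \<in> \<real>" "Some z \<noteq> p" for z
  proof -
    have "psi p (phi p (Some z)) = Some z" using z pE by (intro psi_phi) (auto simp: ext_real_def)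
    then show ?thesis
      using T(3)[OF Q, of "phi p (Some z)"] T(3)[OF P(1), of "phi p (Some z)"] T(4)[of "phi p (Some z)"] TPQ
      by simp
  qed
  have "P = Q"
  proof (rule ccontr)
    assume "P \<noteq> Q"
    then have "finite {z. poly (P - Q) z = 0}" by (intro poly_roots_finite) simp
    then have "finite (insert (case p of Some a \<Rightarrow> a | None \<Rightarrow> 0) {z. poly (P - Q) z = 0})" by simp
    moreover have "\<real> \<subseteq> insert (case p of Some a \<Rightarrow> a | None \<Rightarrow> 0) {z. poly (P - Q) z = 0}"
    proof
      fix z :: complex assume "z \<in> \<real>"
      then show "z \<in> insert (case p of Some a \<Rightarrow> a | None \<Rightarrow> 0) {z. poly (P - Q) z = 0}"
        using eq[of z] by (cases "Some z = p") auto
    qed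
    ultimately have "finite (range (of_real :: real \<Rightarrow> complex))"
      unfolding Reals_def by (rule finite_subset[rotated])
    then have "finite (UNIV :: real set)" by (rule finite_imageD) (simp add: inj_on_def)
    then show False using infinite_UNIV_char_0 by blast
  qed
  then show ?thesis using P(2) by (simp add: rconst_def Q_def eq_fract)
qed

section \<open>Characterization of constant extremal functions\<close>

theorem theorem1p2:
  fixes E :: "complex option set" and D :: "complex option \<Rightarrow> int"
    and xs :: "complex option" and n :: nat and F :: ratfun
  assumes E_sub: "E \<subseteq> ext_real" and E_proper: "E \<noteq> ext_real"
    and E_compact: "compactin sphere_top E" and E_inf: "infinite E"
    and n_pos: "n \<ge> 1"
    and D_div: "is_divisor D" and D_nonneg: "\<forall>p. D p \<ge> 0"
    and D_deg: "div_degree D = int n"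
    and D_supp: "{p. D p \<noteq> 0} \<subseteq> ext_real - E"
    and xs_in: "xs \<in> ext_real - E"
    and F_ext: "is_extremal E D xs F"
  shows "(is_constant_rf F \<longleftrightarrow>
           (\<exists>c :: nat \<Rightarrow> complex option.
              (\<forall>k\<in>{1..n}. c k \<in> ext_real - E) \<and>
              (\<forall>k\<in>{1..n}. \<not> same_gap E xs (c k)) \<and>
              (\<forall>j\<in>{1..n}. \<forall>k\<in>{1..n}. j \<noteq> k \<longrightarrow> \<not> same_gap E (c j) (c k)) \<and>
              (\<forall>p. D p = int (card {k\<in>{1..n}. c k = p}))))
         \<and> (D xs > 0 \<longrightarrow> \<not> is_constant_rf F)"
proof (intro conjI impI iffI)
  have xsE: "xs \<in> ext_real" "xs \<notin> E" using xs_in by auto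
  have F: "admissible E D F"
    and Fmax: "\<And>G. admissible E D G \<Longrightarrow>
      extremal_functional xs (nat (D xs)) G \<le> extremal_functional xs (nat (D xs)) F"
    using F_ext by (auto simp: is_extremal_def)
  have refl: "same_gap E x x" if "x \<in> ext_real - E" for x
    using that by (simp add: same_gap_def connected_component_of_refl)
  show nonconst: "\<not> is_constant_rf F" if "D xs > 0"
  proof
    assume "is_constant_rf F"
    then have F0: "extremal_functional xs (nat (D xs)) F = 0"
      using extremal_functional_rconst[OF xsE(1), of "nat (D xs)"] that by (auto simp: is_constant_rf_def)
    have "D xs = int (nat (D xs))" using that by simp
    then obtain G where "admissible E D G" "extremal_functional xs (nat (D xs)) G > 0"
      by (rule power_competitor[OF E_compact xsE D_nonneg])
    then show False using Fmax F0 by fastforce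
  qed
  have fnl: "extremal_functional xs (nat (D xs)) G = Re (rf_eval G xs)"
    if "D xs = 0" "admissible E D G" for G
    using that extremal_functional_regular[OF D_div D_nonneg xsE(1), of G] by (simp add: admissible_def)
  show "\<exists>c :: nat \<Rightarrow> complex option.
              (\<forall>k\<in>{1..n}. c k \<in> ext_real - E) \<and>
              (\<forall>k\<in>{1..n}. \<not> same_gap E xs (c k)) \<and>
              (\<forall>j\<in>{1..n}. \<forall>k\<in>{1..n}. j \<noteq> k \<longrightarrow> \<not> same_gap E (c j) (c k)) \<and>
              (\<forall>p. D p = int (card {k\<in>{1..n}. c k = p}))"
    if const: "is_constant_rf F"
  proof -
    have D0: "D xs = 0" using nonconst const D_nonneg by (metis not_less order_antisym)
    obtain a where a: "F = rconst a" using const by (auto simp: is_constant_rf_def)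
    obtain e where e: "e \<in> E" using E_inf by (metis ex_in_conv finite.emptyI)
    have "norm a \<le> 1" using F e by (auto simp: admissible_def a rf_eval_rconst)
    then have "Re (rf_eval F xs) \<le> 1"
      using complex_Re_le_cmod[of a] by (simp add: a rf_eval_rconst)
    \<comment> \<open>A constant bounded by 1 on the nonempty set \<open>E\<close> has real part at
      most 1, so any competitor above 1 at \<open>xs\<close> contradicts extremality.\<close>
    then have no_better: "\<not> Re (rf_eval G xs) > 1" if "admissible E D G" for G
      using Fmax[OF that] fnl[OF D0 that] fnl[OF D0 F] by simp
    define S where "S = {p. D p \<noteq> 0}"
    have S: "S \<subseteq> ext_real - E" "finite S" "xs \<notin> S" and SD: "\<And>p. p \<in> S \<Longrightarrow> D p \<ge> 1"
      using D_supp D_div D0 D_nonneg by (auto simp: S_def is_divisor_def) (smt (verit))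
    have sep: "\<not> same_gap E xs p" if pS: "p \<in> S" for p
    proof
      assume "same_gap E xs p"
      moreover have "p \<in> ext_real - E" "xs \<noteq> p" using S pS by auto
      ultimately obtain G where "admissible E D G" "Re (rf_eval G xs) > 1"
        using same_gap_pole_competitor[OF E_sub E_compact xs_in _ _ _ D_nonneg SD[OF pS]] by metis
      then show False using no_better by blast
    qed
    have pair: False
      if pq: "p \<in> S" "q \<in> S" "same_gap E p q" "\<And>r. (if r = p then 1 else 0) + (if r = q then 1 else 0) \<le> D r" for p q
    proof -
      have "p \<in> ext_real - E" "q \<in> ext_real - E" "xs \<noteq> p" "xs \<noteq> q" using S pq(1,2) by auto
      then obtain G where "admissible E D G" "Re (rf_eval G xs) > 1"
        by (rule pole_pair_competitor[OF E_sub E_compact xs_in _ _ pq(3) _ _ D_nonneg pq(4)])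
      then show False using no_better by blast
    qed
    \<comment> \<open>A multiple pole is excluded as the pair \<open>(p, p)\<close>, which lies in
      one gap by reflexivity.\<close>
    have D1: "D p = 1" if "p \<in> S" for p
    proof (rule ccontr)
      assume "D p \<noteq> 1"
      then have "D p \<ge> 2" using SD[OF that] by simp
      then have "(if r = p then 1 else 0) + (if r = p then 1 else 0) \<le> D r" for r
        using D_nonneg by (cases "r = p") simp_all
      moreover have "same_gap E p p" using refl S(1) that by blast
      ultimately show False using pair[OF that that] by blast
    qed
    have sep2: "\<not> same_gap E p q" if "p \<in> S" "q \<in> S" "p \<noteq> q" for p q
    proof -
      have "(if r = p then 1 else 0) + (if r = q then 1 else 0) \<le> D r" for r
        using D_nonneg SD[OF that(1)] SD[OF that(2)] that(3) by (cases "r = p"; cases "r = q") simp_all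
      then show ?thesis using pair[OF that(1,2)] by blast
    qed
    \<comment> \<open>With all multiplicities equal to 1, the degree counts the poles, so they can
      be enumerated by \<open>{1..n}\<close>.\<close>
    have "div_degree D = (\<Sum>p\<in>S. 1)"
      unfolding div_degree_def S_def[symmetric] using D1 by (intro sum.cong) auto
    then have "card S = n" using D_deg by simp
    then obtain c where c: "bij_betw c {1..n} S"
      using S(2) finite_same_card_bij[of "{1..n}" S] by auto
    then have cS: "c k \<in> S" if "k \<in> {1..n}" for k using that by (rule bij_betw_apply)
    have Dcard: "D p = int (card {k\<in>{1..n}. c k = p})" for p
    proof (cases "p \<in> S")
      case True
      then obtain k where k: "k \<in> {1..n}" "c k = p" using c by (auto simp: bij_betw_def)
      then have "{k\<in>{1..n}. c k = p} = {k}" using c by (auto simp: bij_betw_def dest: inj_onD)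
      then show ?thesis using D1[OF True] by simp
    next
      case False
      then have "{k\<in>{1..n}. c k = p} = {}" using cS by auto
      then show ?thesis using False by (simp only: S_def) simp
    qed
    have cne: "c j \<noteq> c k" if "j \<in> {1..n}" "k \<in> {1..n}" "j \<noteq> k" for j k
      using c that by (auto simp: bij_betw_def dest: inj_onD)
    show ?thesis
    proof (rule exI[of _ c], intro conjI ballI allI impI)
      show "c k \<in> ext_real - E" if "k \<in> {1..n}" for k by (rule subsetD[OF S(1) cS[OF that]])
      show "\<not> same_gap E xs (c k)" if "k \<in> {1..n}" for k by (rule sep[OF cS[OF that]])
      show "\<not> same_gap E (c j) (c k)" if "j \<in> {1..n}" "k \<in> {1..n}" "j \<noteq> k" for j k
        using that by (intro sep2 cS cne)
      show "D p = int (card {k\<in>{1..n}. c k = p})" for p by (rule Dcard)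
    qed
  qed
  show "is_constant_rf F" if ex: "\<exists>c :: nat \<Rightarrow> complex option.
              (\<forall>k\<in>{1..n}. c k \<in> ext_real - E) \<and>
              (\<forall>k\<in>{1..n}. \<not> same_gap E xs (c k)) \<and>
              (\<forall>j\<in>{1..n}. \<forall>k\<in>{1..n}. j \<noteq> k \<longrightarrow> \<not> same_gap E (c j) (c k)) \<and>
              (\<forall>p. D p = int (card {k\<in>{1..n}. c k = p}))"
  proof -
    obtain c where c: "\<forall>k\<in>{1..n}. c k \<in> ext_real - E" "\<forall>k\<in>{1..n}. \<not> same_gap E xs (c k)"
      "\<forall>j\<in>{1..n}. \<forall>k\<in>{1..n}. j \<noteq> k \<longrightarrow> \<not> same_gap E (c j) (c k)"
      and Dc: "\<And>p. D p = int (card {k\<in>{1..n}. c k = p})"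
      using ex by blast
    \<comment> \<open>\<open>xs\<close> lies in its own gap, which contains no pole.\<close>
    have "{k\<in>{1..n}. c k = xs} = {}" using c(2) refl[OF xs_in] by auto
    then have D0: "D xs = 0" unfolding Dc by simp
    have cD: "\<forall>k\<in>{1..n}. D (c k) > 0"
      unfolding Dc by (auto simp: card_gt_0_iff)
    have inj: "inj_on c {1..n}"
      by (rule inj_onI) (metis c(1,3) refl)
    \<comment> \<open>The constant 1 is a competitor, which forces the extremal value up to at least
      1.\<close>
    have one: "admissible E D (rconst 1)"
      using D_nonneg by (simp add: admissible_def rconst_in_Lspace rf_eval_rconst)
    have Fxs: "Re (rf_eval F xs) \<ge> 1"
      using Fmax[OF one] fnl[OF D0 one] fnl[OF D0 F] by (simp add: rf_eval_rconst)
    have "\<forall>e\<in>E. D e = 0" "E \<noteq> {}" using D_supp E_inf by auto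
    then have "F = rconst 1"
      by (intro separated_gaps_rigid[OF xs_in E_sub _ D_div D_nonneg D_deg D0 c cD inj _ F Fxs])
    then show ?thesis by (auto simp: is_constant_rf_def)
  qed
qed

end
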